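(* Let $G$ be a $(P_5,\textit{HVN})$-free graph that contains an induced $Y$-5-wheel and contains no induced $T$-5-wheel. Then $G$ is $(\omega(G)+3)$-colorable.
   Context: Graphs are finite, simple and connected. $P_5$ is the path on 5 vertices; an HVN is a $K_4$ plus a vertex adjacent to exactly two vertices of the $K_4$; $(H_1,H_2)$-free means no induced $H_1$ or $H_2$. A $T$-5-wheel is a chordless 5-cycle $v_1v_2v_3v_4v_5v_1$ plus a vertex adjacent to exactly three consecutive vertices of it (e.g. $v_5,v_1,v_2$). A $Y$-5-wheel is a chordless 5-cycle $v_1v_2v_3v_4v_5v_1$ plus a vertex adjacent to exactly $v_1,v_2,v_4$. $\omega(G)$ is the clique number. *)

theory Defs
  imports "Graph_Theory.Digraph_Isomorphism"
begin

text \<open>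
  A finite simple graph is a \<open>pair_graph\<close>: finitely many vertices and a symmetric, loop-free
  set of ordered pairs, so that each edge \<open>uv\<close> is stored as both \<open>(u, v)\<close> and \<open>(v, u)\<close>.
\<close>

definition contains_induced :: "'a pair_pre_digraph \<Rightarrow> 'b pair_pre_digraph \<Rightarrow> bool" where
  "contains_induced G H \<longleftrightarrow>
    (\<exists>S \<subseteq> pverts G. digraph_iso (with_proj H) (induce_subgraph (with_proj G) S))"

definition clique_in :: "'a pair_pre_digraph \<Rightarrow> 'a set \<Rightarrow> bool" where
  "clique_in G S \<longleftrightarrow> S \<subseteq> pverts G \<and> (\<forall>u \<in> S. \<forall>v \<in> S. u \<noteq> v \<longrightarrow> (u, v) \<in> parcs G)"

definition clique_number :: "'a pair_pre_digraph \<Rightarrow> nat" where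
  "clique_number G = Max (card ` {S. clique_in G S})"

definition colorable :: "'a pair_pre_digraph \<Rightarrow> nat \<Rightarrow> bool" where
  "colorable G k \<longleftrightarrow> (\<exists>c :: 'a \<Rightarrow> nat.
    (\<forall>v \<in> pverts G. c v < k) \<and> (\<forall>(u, v) \<in> parcs G. c u \<noteq> c v))"

text \<open>Each edge is listed once; \<open>mk_symmetric\<close> adds the reverse pairs.\<close>

definition graph_of :: "'a set \<Rightarrow> ('a \<times> 'a) set \<Rightarrow> 'a pair_pre_digraph" where
  "graph_of V E = mk_symmetric (with_proj \<lparr>pverts = V, parcs = E\<rparr>)"

definition P5 :: "nat pair_pre_digraph" where
  "P5 = graph_of {1, 2, 3, 4, 5} {(1, 2), (2, 3), (3, 4), (4, 5)}"

text \<open>The \<open>K\<^sub>4\<close> is on \<open>{1, 2, 3, 4}\<close>.\<close>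

definition HVN :: "nat pair_pre_digraph" where
  "HVN = graph_of {1, 2, 3, 4, 5}
    ({(1, 2), (1, 3), (1, 4), (2, 3), (2, 4), (3, 4)} \<union> {(5, 1), (5, 2)})"

text \<open>In both wheels the chordless 5-cycle is on \<open>{1, 2, 3, 4, 5}\<close> and the extra vertex is 6.\<close>

definition T_5_wheel :: "nat pair_pre_digraph" where
  "T_5_wheel = graph_of {1, 2, 3, 4, 5, 6}
    ({(1, 2), (2, 3), (3, 4), (4, 5), (5, 1)} \<union> {(6, 5), (6, 1), (6, 2)})"

definition Y_5_wheel :: "nat pair_pre_digraph" where
  "Y_5_wheel = graph_of {1, 2, 3, 4, 5, 6}
    ({(1, 2), (2, 3), (3, 4), (4, 5), (5, 1)} \<union> {(6, 1), (6, 2), (6, 4)})"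

lemma pverts_graph_of [simp]: "pverts (graph_of V E) = V"
  and parcs_graph_of [simp]: "parcs (graph_of V E) = E \<union> E\<inverse>"
  by (auto simp: graph_of_def mk_symmetric_def)

lemma pair_wf_digraph_graph_of:
  assumes "E \<subseteq> V \<times> V"
  shows "pair_wf_digraph (graph_of V E)"
  using assms by unfold_locales auto

lemma contains_induced_iff_embedding:
  assumes "pair_wf_digraph H"
  shows "contains_induced G H \<longleftrightarrow>
    (\<exists>f. inj_on f (pverts H) \<and> f ` pverts H \<subseteq> pverts G \<and>
      (\<forall>u \<in> pverts H. \<forall>v \<in> pverts H. (u, v) \<in> parcs H \<longleftrightarrow> (f u, f v) \<in> parcs G))"
    (is "_ \<longleftrightarrow> ?R")
proof -
  interpret H: pair_wf_digraph H by fact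
  have wf: "wf_digraph (with_proj H)" ..
  show ?thesis
  proof
    assume "contains_induced G H"
    then obtain S h where S: "S \<subseteq> pverts G"
      and h: "pre_digraph.digraph_isomorphism (with_proj H) h"
      and eq: "induce_subgraph (with_proj G) S = app_iso h (with_proj H)"
      by (auto simp: contains_induced_def digraph_iso_def)
    let ?f = "iso_verts h" and ?g = "iso_arcs h"
    have tl: "iso_tail h = fst" and hd: "iso_head h = snd"
      using arg_cong[OF eq, of tail] arg_cong[OF eq, of head] by auto
    have S_eq: "S = ?f ` pverts H" using arg_cong[OF eq, of verts] by simp
    have inj: "inj_on ?f (pverts H)"
      using h by (simp add: pre_digraph.digraph_isomorphism_def)
    have g: "?g (u, v) = (?f u, ?f v)" if "(u, v) \<in> parcs H" for u v
      using h that tl hd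
      by (force simp: pre_digraph.digraph_isomorphism_def prod_eq_iff)
    have arcs: "{e \<in> parcs G. fst e \<in> S \<and> snd e \<in> S} = ?g ` parcs H"
      using arg_cong[OF eq, of arcs] by simp
    have "(u, v) \<in> parcs H \<longleftrightarrow> (?f u, ?f v) \<in> parcs G"
      if "u \<in> pverts H" "v \<in> pverts H" for u v
    proof
      assume "(u, v) \<in> parcs H"
      then have "(?f u, ?f v) \<in> ?g ` parcs H" using g by force
      then show "(?f u, ?f v) \<in> parcs G" using arcs by blast
    next
      assume "(?f u, ?f v) \<in> parcs G"
      then have "(?f u, ?f v) \<in> ?g ` parcs H" using arcs S_eq that by auto
      then obtain x y where xy: "(x, y) \<in> parcs H" "(?f u, ?f v) = ?g (x, y)" by auto
      then have "?f u = ?f x" "?f v = ?f y" using g by auto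
      moreover have "x \<in> pverts H" "y \<in> pverts H"
        using xy(1) H.wellformed' by blast+
      ultimately show "(u, v) \<in> parcs H" using inj that xy(1) by (metis inj_onD)
    qed
    then show ?R using inj S S_eq by blast
  next
    assume ?R
    then obtain f where inj: "inj_on f (pverts H)" and sub: "f ` pverts H \<subseteq> pverts G"
      and arcs: "\<And>u v. u \<in> pverts H \<Longrightarrow> v \<in> pverts H \<Longrightarrow>
        (u, v) \<in> parcs H \<longleftrightarrow> (f u, f v) \<in> parcs G"
      by blast
    let ?h = "\<lparr>iso_verts = f, iso_arcs = map_prod f f, iso_head = snd, iso_tail = fst\<rparr>"
    have injg: "inj_on (map_prod f f) (parcs H)"
      by (rule inj_on_subset[OF map_prod_inj_on[OF inj inj]]) (auto dest: H.wellformed')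
    have "pre_digraph.digraph_isomorphism (with_proj H) ?h"
      using wf inj injg by (simp add: pre_digraph.digraph_isomorphism_def)
    moreover have "induce_subgraph (with_proj G) (f ` pverts H) = app_iso ?h (with_proj H)"
    proof -
      have "{e \<in> parcs G. fst e \<in> f ` pverts H \<and> snd e \<in> f ` pverts H}
          = map_prod f f ` parcs H" (is "?A = ?B")
      proof
        show "?A \<subseteq> ?B"
        proof (rule subsetI)
          fix e assume e: "e \<in> ?A"
          then obtain u v where uv: "u \<in> pverts H" "v \<in> pverts H" "e = (f u, f v)"
            by (cases e) auto
          then have "(u, v) \<in> parcs H" using arcs e by simp
          then show "e \<in> ?B" using uv(3) by force
        qed
        show "?B \<subseteq> ?A"
        proof (rule subsetI)
          fix e assume "e \<in> ?B"
          then obtain u v where uv: "(u, v) \<in> parcs H" "e = (f u, f v)" by auto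
          moreover from uv(1) have "u \<in> pverts H" "v \<in> pverts H"
            by (blast dest: H.wellformed')+
          ultimately show "e \<in> ?A" using arcs by simp
        qed
      qed
      then show ?thesis by (simp add: induce_subgraph_def app_iso_def)
    qed
    ultimately show "contains_induced G H"
      using sub by (auto simp: contains_induced_def digraph_iso_def)
  qed
qed

end

theory Submission
  imports Defs "HOL-Library.Numeral_Type"
begin

text \<open>
  Around an induced 5-cycle \<open>v\<close>, a vertex is adjacent to two non-consecutive cycle vertices (\<open>A\<close>), to
  three non-consecutive ones (\<open>Y\<close>), to all but one (\<open>F\<close>), to all (\<open>W\<close>) or to none (\<open>D\<close>); other
  patterns give a \<open>P\<^sub>5\<close> or a T-5-wheel. Each \<open>A i\<close> and each \<open>Y i\<close> is stable, \<open>F \<union> W\<close> is stable, and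
  \<open>D\<close> has no edge to the \<open>A i\<close>. For a suitable cycle the ten sets \<open>A i\<close>, \<open>Y i\<close> can be regrouped into
  five stable sets, so that five colours suffice for them and a sixth one is used on \<open>F \<union> W\<close>.

  Every component \<open>Q\<close> of \<open>D\<close> lies in the neighbourhood of a single vertex, hence induces a paw-free
  graph, and is therefore triangle-free (then 3-colourable) or complete multipartite (then
  \<open>\<omega> - 1\<close> colours suffice). If \<open>Q\<close> has an edge, its neighbours of type \<open>Y\<close> are stable, so \<open>Q\<close> sees at most
  three of the six colours and \<open>\<omega>\<close> colours remain for it. If \<open>Q\<close> is a single vertex seeing all six
  colours, then \<open>\<omega> \<ge> 4\<close> and a seventh colour is available.
\<close>

section \<open>Vertex types around an induced 5-cycle\<close>

text \<open>\<open>A v i\<close> is complete to \<open>Y v i\<close> and to the two neighbouring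
  classes of type \<open>A\<close>, and a vertex of \<open>A v i\<close> may see any part of the
  remaining classes \<open>Y\<close>, so no regrouping works for all graphs. Two devices help.
  First, if a class has no vertex with neighbours in both \<open>Y v i\<close> and
  \<open>Y v (i + 1)\<close>, it is divided between the colours of these two; vertices in the same
  part of such classes agree on a fixed vertex of type \<open>Y\<close>, which excludes an edge
  between them. Second, the cycle is chosen: if some induced 5-cycle has two consecutive non-empty
  classes \<open>Y\<close>, that cycle is used. Otherwise no induced 5-cycle has them, and applying
  this to the cycle with \<open>v i\<close> exchanged for a vertex of \<open>A v i\<close> supplies
  the missing non-adjacencies.

  An isolated vertex of \<open>D\<close> is dangerous only if five colours occur on type
  \<open>Y\<close>. All colourings but one avoid this by using at most four there; the exception has
  all classes \<open>Y\<close> in different colours, and then \<open>W v\<close> is empty and the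
  vertices of type \<open>F\<close> provide the required \<open>K4\<close>.\<close>

lemma five_cases: "j = i \<or> j = i+1 \<or> j = i+2 \<or> j = i+3 \<or> j = i+4" for i j :: 5
proof -
  have "j - i = 0 \<or> j - i = 1 \<or> j - i = 2 \<or> j - i = 3 \<or> j - i = 4"
  proof (cases "j - i")
    case (of_int z)
    then have "z = 0 \<or> z = 1 \<or> z = 2 \<or> z = 3 \<or> z = 4" by auto
    then show ?thesis using of_int by auto
  qed
  then show ?thesis by (metis add.commute add.right_neutral diff_add_cancel)
qed

lemma all_five: "(\<forall>j. P j) \<longleftrightarrow> P i \<and> P (i+1) \<and> P (i+2) \<and> P (i+3) \<and> P (i+4)" for i :: 5
  using five_cases by metis

lemma all_five_minus: "(\<forall>j::5. P j) \<longleftrightarrow> (\<forall>j. P (- j))"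
  by (metis minus_minus)

text \<open>Mirrored index conditions reach this shape because simp turns \<open>- i + c\<close>
  into \<open>c - i\<close>; the rule brings them back to the unreflected index.\<close>

lemma minus_eq_diff_iff: "- j = c - i \<longleftrightarrow> j = i + - c" for i j c :: "'b::ab_group_add"
  by (metis add.inverse_inverse minus_diff_eq uminus_add_conv_diff add.commute)

lemma minus_five: "- (1::5) = 4" "- (2::5) = 3" "- (3::5) = 2" "- (4::5) = 1"
  by simp_all

lemmas minus_five_eq =
  minus_eq_diff_iff[of j "1::5" i for i j, unfolded minus_five]
  minus_eq_diff_iff[of j "2::5" i for i j, unfolded minus_five]
  minus_eq_diff_iff[of j "3::5" i for i j, unfolded minus_five]
  minus_eq_diff_iff[of j "4::5" i for i j, unfolded minus_five]

lemma range_minus_five: "range (uminus :: 5 \<Rightarrow> 5) = UNIV"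
  by (metis minus_minus surj_def)

text \<open>The forbidden patterns carry no distinctness conditions: the listed adjacencies and
  non-adjacencies already separate the vertices.\<close>

locale wheel_graph =
  fixes V :: "'a set" and adj :: "'a \<Rightarrow> 'a \<Rightarrow> bool"
  assumes finite_V: "finite V"
    and adj_V: "adj x y \<Longrightarrow> x \<in> V"
    and adj_irrefl: "\<not> adj x x"
    and adj_sym: "adj x y = adj y x"
    and no_P5: "\<not> (adj a b \<and> adj b c \<and> adj c d \<and> adj d e \<and>
      \<not> adj a c \<and> \<not> adj a d \<and> \<not> adj a e \<and> \<not> adj b d \<and> \<not> adj b e \<and> \<not> adj c e)"
    and no_HVN: "\<not> (adj a b \<and> adj a c \<and> adj a d \<and> adj b c \<and> adj b d \<and> adj c d \<and>
      adj e a \<and> adj e b \<and> \<not> adj e c \<and> \<not> adj e d)"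
    and no_T: "\<not> (adj a b \<and> adj b c \<and> adj c d \<and> adj d e \<and> adj e a \<and>
      \<not> adj a c \<and> \<not> adj a d \<and> \<not> adj b d \<and> \<not> adj b e \<and> \<not> adj c e \<and>
      adj x e \<and> adj x a \<and> adj x b \<and> \<not> adj x c \<and> \<not> adj x d)"
begin

definition cyc :: "(5 \<Rightarrow> 'a) \<Rightarrow> bool" where
  "cyc v \<longleftrightarrow> (\<forall>i j. adj (v i) (v j) \<longleftrightarrow> j = i + 1 \<or> j = i + 4)"

definition A :: "(5 \<Rightarrow> 'a) \<Rightarrow> 5 \<Rightarrow> 'a set" where
  "A v i = {x. \<forall>j. adj x (v j) \<longleftrightarrow> j = i + 1 \<or> j = i + 4}"

definition Y :: "(5 \<Rightarrow> 'a) \<Rightarrow> 5 \<Rightarrow> 'a set" where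
  "Y v i = {x. \<forall>j. adj x (v j) \<longleftrightarrow> j = i \<or> j = i + 2 \<or> j = i + 3}"

definition F :: "(5 \<Rightarrow> 'a) \<Rightarrow> 5 \<Rightarrow> 'a set" where
  "F v i = {x. \<forall>j. adj x (v j) \<longleftrightarrow> j \<noteq> i}"

definition W :: "(5 \<Rightarrow> 'a) \<Rightarrow> 'a set" where
  "W v = {x. \<forall>j. adj x (v j)}"

definition D :: "(5 \<Rightarrow> 'a) \<Rightarrow> 'a set" where
  "D v = {x \<in> V. \<forall>j. \<not> adj x (v j)}"

section \<open>Adjacencies forced between two types\<close>

context
  fixes v :: "5 \<Rightarrow> 'a"
  assumes cyc: "cyc v"
begin

lemma v_adj: "adj (v i) (v j) \<longleftrightarrow> j = i + 1 \<or> j = i + 4"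
  using cyc by (simp add: cyc_def)

lemma v_in_A: "v i \<in> A v i"
  by (simp add: A_def v_adj)

lemma A_adj: "x \<in> A v i \<Longrightarrow> \<forall>j. (adj x (v j) \<longleftrightarrow> j = i + 1 \<or> j = i + 4) \<and> (adj (v j) x \<longleftrightarrow> j = i + 1 \<or> j = i + 4)"
  by (simp add: A_def adj_sym[of "v _"])

lemma Y_adj: "x \<in> Y v i \<Longrightarrow> \<forall>j. (adj x (v j) \<longleftrightarrow> j = i \<or> j = i + 2 \<or> j = i + 3) \<and> (adj (v j) x \<longleftrightarrow> j = i \<or> j = i + 2 \<or> j = i + 3)"
  by (simp add: Y_def adj_sym[of "v _"])

lemma F_adj: "x \<in> F v i \<Longrightarrow> \<forall>j. (adj x (v j) \<longleftrightarrow> j \<noteq> i) \<and> (adj (v j) x \<longleftrightarrow> j \<noteq> i)"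
  by (simp add: F_def adj_sym[of "v _"])

lemma W_adj: "x \<in> W v \<Longrightarrow> \<forall>j. adj x (v j) \<and> adj (v j) x"
  by (simp add: W_def adj_sym[of "v _"])

lemma D_adj: "x \<in> D v \<Longrightarrow> \<forall>j. \<not> adj x (v j) \<and> \<not> adj (v j) x"
  by (simp add: D_def adj_sym[of "v _"])

text \<open>Putting \<open>x\<close> in the place of \<open>v i\<close> gives an induced 5-cycle,
  and an edge \<open>xy\<close> would make \<open>y\<close> the centre of a T-5-wheel on it.\<close>

lemma A_stable: "x \<in> A v i \<Longrightarrow> y \<in> A v i \<Longrightarrow> \<not> adj x y"
  using no_T[of x "v (i+1)" "v (i+2)" "v (i+3)" "v (i+4)" y] A_adj[of x i] A_adj[of y i]
  by (simp add: v_adj adj_sym)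

text \<open>The index relation is a hypothesis rather than part of the term
  \<open>A v (i + 1)\<close>, so that a use at another base index only needs an equation in type
  \<open>5\<close>. Many later lemmas have the same form.\<close>

lemma A_A_complete: "x \<in> A v i \<Longrightarrow> y \<in> A v j \<Longrightarrow> j = i + 1 \<Longrightarrow> adj x y"
  using no_P5[of "v (i+4)" x "v (i+1)" "v (i+2)" y] A_adj[of x i] A_adj[of y j]
  by (simp add: v_adj adj_sym)

lemma A_Y_complete: "x \<in> A v i \<Longrightarrow> y \<in> Y v i \<Longrightarrow> adj x y"
  using no_P5[of "v (i+2)" y "v i" "v (i+4)" x] A_adj[of x i] Y_adj[of y "i"]
  by (simp add: v_adj adj_sym)

lemma Y_stable: "x \<in> Y v i \<Longrightarrow> y \<in> Y v i \<Longrightarrow> \<not> adj x y"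
  using no_HVN[of x y "v (i+2)" "v (i+3)" "v i"] Y_adj[of x i] Y_adj[of y i]
  by (simp add: v_adj adj_sym)

lemma Y_Y_complete: "x \<in> Y v i \<Longrightarrow> y \<in> Y v j \<Longrightarrow> j = i + 1 \<Longrightarrow> adj x y"
  using no_P5[of "v (i+4)" y "v (i+1)" "v (i+2)" x] Y_adj[of x i] Y_adj[of y j]
  by (simp add: v_adj adj_sym)

text \<open>If adjacent, \<open>x\<close> and \<open>y\<close> form a \<open>K4\<close> with two
  consecutive cycle vertices, and a further cycle vertex completes an HVN. Which cycle vertices
  serve depends on the distance of the two missed indices.\<close>

lemma F_F_anticomplete: "x \<in> F v i \<Longrightarrow> y \<in> F v j \<Longrightarrow> \<not> adj x y"
proof -
  assume x: "x \<in> F v i" and y: "y \<in> F v j"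
  note xy = F_adj[OF x] F_adj[OF y]
  consider "j = i" | "j = i + 1" | "i = j + 1" | "j = i + 2" | "i = j + 2"
    using five_cases[of j i] by force
  then show ?thesis
  proof cases
    case 1 then show ?thesis using xy no_HVN[of x y "v (i+3)" "v (i+4)" "v (i+1)"]
      by (simp add: v_adj adj_sym)
  next
    case 2 then show ?thesis using xy no_HVN[of "v (i+4)" y "v (i+3)" x "v i"]
      by (simp add: v_adj adj_sym)
  next
    case 3 then show ?thesis using xy no_HVN[of "v (j+4)" x "v (j+3)" y "v j"]
      by (simp add: v_adj adj_sym)
  next
    case 4 then show ?thesis using xy no_HVN[of "v (i+3)" x "v (i+4)" y "v (i+2)"]
      by (simp add: v_adj adj_sym)
  next
    case 5 then show ?thesis using xy no_HVN[of "v (j+3)" y "v (j+4)" x "v (j+2)"]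
      by (simp add: v_adj adj_sym)
  qed
qed

lemma F_W_anticomplete: "x \<in> F v i \<Longrightarrow> y \<in> W v \<Longrightarrow> \<not> adj x y"
  using no_HVN[of x y "v (i+1)" "v (i+2)" "v (i+4)"] F_adj[of x i] W_adj[of y]
  by (simp add: v_adj adj_sym)

lemma W_stable: "x \<in> W v \<Longrightarrow> y \<in> W v \<Longrightarrow> \<not> adj x y"
  using no_HVN[of x y "v 2" "v 3" "v 0"] W_adj[of x] W_adj[of y]
  by (simp add: v_adj adj_sym)

lemma Y_W_anticomplete: "x \<in> Y v i \<Longrightarrow> y \<in> W v \<Longrightarrow> \<not> adj x y"
  using no_HVN[of "v (i+2)" y "v (i+3)" x "v (i+1)"] Y_adj[of x i] W_adj[of y]
  by (simp add: v_adj adj_sym)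

lemma F_Y_complete: "x \<in> F v i \<Longrightarrow> y \<in> Y v (i+2) \<Longrightarrow> adj x y"
  using no_P5[of "v (i+3)" x "v (i+1)" "v i" y] F_adj[of x i] Y_adj[of y "i+2"]
  by (simp add: v_adj adj_sym)

lemma A_D_anticomplete: "x \<in> A v i \<Longrightarrow> y \<in> D v \<Longrightarrow> \<not> adj x y"
  using no_P5[of "v (i+2)" "v (i+3)" "v (i+4)" x y] A_adj[of x i] D_adj[of y]
  by (simp add: v_adj adj_sym)

section \<open>Constraints on three or more vertices\<close>

lemma Y_no_common_neighbour:
  "x \<in> Y v i \<Longrightarrow> y \<in> Y v j \<Longrightarrow> z \<in> Y v k \<Longrightarrow> j = i + 1 \<Longrightarrow> k = i + 3 \<Longrightarrow>
    \<not> (adj x z \<and> adj y z)"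
  using no_HVN[of "v (i+3)" x y z "v (i+2)"] Y_Y_complete[of x i y j]
    Y_adj[of x i] Y_adj[of y j] Y_adj[of z k]
  by (simp add: v_adj adj_sym)

text \<open>An edge \<open>xz\<close> gives an induced \<open>P5\<close> if both miss
  \<open>y\<close> and an HVN if both see it. The case of both missing it is what makes the divided
  classes stable.\<close>

lemma A_A_anticomplete:
  "x \<in> A v j \<Longrightarrow> z \<in> A v k \<Longrightarrow> y \<in> Y v i \<Longrightarrow> j = i + 2 \<Longrightarrow> k = i + 4 \<Longrightarrow>
    adj x y = adj z y \<Longrightarrow> \<not> adj x z"
  using no_P5[of "v (i+2)" y "v i" z x] no_HVN[of z y "v (i+3)" x "v i"]
    A_adj[of x j] A_adj[of z k] Y_adj[of y i]
  by (cases "adj x y") (simp_all add: v_adj adj_sym)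

text \<open>Without the edge \<open>xz\<close>, the vertices \<open>z\<close>, \<open>v i\<close>,
  \<open>v (i+1)\<close>, \<open>x\<close>, \<open>v (i+3)\<close> form another induced 5-cycle, on
  which \<open>y\<close> is the centre of a T-5-wheel.\<close>

lemma A_A_complete':
  "x \<in> A v j \<Longrightarrow> z \<in> A v k \<Longrightarrow> y \<in> Y v i \<Longrightarrow> j = i + 2 \<Longrightarrow> k = i + 4 \<Longrightarrow>
    \<not> adj x y \<Longrightarrow> adj z y \<Longrightarrow> adj x z"
  using no_T[of z "v i" "v (i+1)" x "v (i+3)" y]
    A_adj[of x j] A_adj[of z k] Y_adj[of y i]
  by (simp add: v_adj adj_sym)

lemma A_not_both:
  "x \<in> A v i \<Longrightarrow> y \<in> Y v j \<Longrightarrow> z \<in> Y v k \<Longrightarrow> j = i + 1 \<Longrightarrow> k = i + 2 \<Longrightarrow>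
    \<not> (adj x y \<and> adj x z)"
  using no_HVN[of "v (i+4)" y x z "v (i+3)"] Y_Y_complete[of y j z k]
    A_adj[of x i] Y_adj[of y j] Y_adj[of z k]
  by (simp add: v_adj adj_sym)

lemma A_cover:
  "x \<in> A v j \<Longrightarrow> z \<in> A v k \<Longrightarrow> y \<in> Y v i \<Longrightarrow> j = i + 2 \<Longrightarrow> k = i + 3 \<Longrightarrow>
    adj x y \<or> adj z y"
  using no_P5[of z x "v (i+1)" "v i" y] A_A_complete[of x j z k]
    A_adj[of x j] A_adj[of z k] Y_adj[of y i]
  by (simp add: v_adj adj_sym) blast

text \<open>If \<open>z\<close> saw neither end of the edge \<open>xy\<close> there would be an
  induced \<open>P5\<close>, if it saw both an HVN.\<close>

lemma A_Y_Y_dist3: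
  "x \<in> A v i \<Longrightarrow> y \<in> Y v j \<Longrightarrow> z \<in> Y v k \<Longrightarrow> j = i + 1 \<Longrightarrow> k = i + 3 \<Longrightarrow>
    adj x y \<Longrightarrow> adj x z \<noteq> adj y z"
  using no_P5[of "v i" z "v (i+3)" y x] no_HVN[of "v (i+1)" z x y "v i"]
    A_adj[of x i] Y_adj[of y j] Y_adj[of z k]
  by (cases "adj x z") (simp_all add: v_adj adj_sym)

lemma A_Y_Y_dist2:
  "x \<in> A v i \<Longrightarrow> y \<in> Y v j \<Longrightarrow> z \<in> Y v k \<Longrightarrow> j = i + 1 \<Longrightarrow> k = i + 4 \<Longrightarrow>
    adj x y \<Longrightarrow> adj x z \<noteq> adj y z"
  using no_P5[of x y "v (i+3)" "v (i+2)" z] no_HVN[of "v (i+1)" z x y "v (i+2)"]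
    A_adj[of x i] Y_adj[of y j] Y_adj[of z k]
  by (cases "adj x z") (simp_all add: v_adj adj_sym)

lemma A_Y_Y_Y:
  "x \<in> A v i \<Longrightarrow> a \<in> Y v i \<Longrightarrow> y \<in> Y v j \<Longrightarrow> z \<in> Y v k \<Longrightarrow> j = i + 2 \<Longrightarrow> k = i + 3 \<Longrightarrow>
    \<not> adj x y \<Longrightarrow> \<not> adj x z \<Longrightarrow> adj a y \<or> adj a z"
  using no_P5[of a x "v (i+4)" y z] A_Y_complete[of x i a] Y_Y_complete[of y j z k]
    A_adj[of x i] Y_adj[of a i] Y_adj[of y j] Y_adj[of z k]
  by (simp add: v_adj adj_sym)

lemma A_A_Y_Y_dist3:
  "x \<in> A v i \<Longrightarrow> z \<in> A v k \<Longrightarrow> y \<in> Y v i \<Longrightarrow> w \<in> Y v k \<Longrightarrow> k = i + 3 \<Longrightarrow>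
    adj x z \<Longrightarrow> adj x w \<Longrightarrow> adj z y \<Longrightarrow> \<not> adj y w"
  using no_HVN[of y w x z "v i"] A_Y_complete[of x i y] A_Y_complete[of z k w]
    A_adj[of x i] A_adj[of z k] Y_adj[of y i] Y_adj[of w k]
  by (simp add: v_adj adj_sym)

text \<open>An edge \<open>x3 x5\<close> closes a triangle with \<open>x4\<close>. Then
  \<open>P5\<close> and HVN alternately force that \<open>a\<close> sees \<open>c\<close>, misses
  \<open>x4\<close> and sees \<open>x3\<close>, so that \<open>a\<close>, \<open>x3\<close>,
  \<open>x5\<close>, \<open>v (i+3)\<close> are a \<open>K4\<close> which \<open>v i\<close> extends
  to an HVN.\<close>

lemma A_A_anticomplete_bad:
  assumes a: "a \<in> Y v i" and c: "c \<in> Y v k"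
    and x3: "x3 \<in> A v k" and x4: "x4 \<in> A v l" and x5: "x5 \<in> A v m"
    and idx: "k = i + 2" "l = i + 3" "m = i + 4"
    and x4c: "adj x4 c" and x5a: "adj x5 a"
  shows "\<not> adj x3 x5"
proof
  assume x35: "adj x3 x5"
  note adjs = A_adj[OF x3] A_adj[OF x4] A_adj[OF x5] Y_adj[OF a] Y_adj[OF c]
  have x345: "adj x3 x4" "adj x4 x5" "adj x3 c"
    using A_A_complete[OF x3 x4] A_A_complete[OF x4 x5] A_Y_complete[OF x3 c] by (simp_all add: idx)
  have "\<not> adj c x5"
    using no_HVN[of c x4 x5 x3 "v (i+4)"] adjs x345 x4c x35 by (simp add: idx adj_sym)
  then have ac: "adj a c"
    using no_P5[of "v (i+4)" c "v (i+2)" a x5] adjs x5a by (simp add: v_adj idx adj_sym)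
  then have "\<not> adj a x4"
    using no_HVN[of "v (i+2)" a c x4 "v (i+3)"] adjs x4c by (simp add: v_adj idx adj_sym)
  then have "adj a x3"
    using no_P5[of a "v i" "v (i+4)" x4 x3] adjs x345 by (simp add: v_adj idx adj_sym)
  then show False
    using no_HVN[of a x5 "v (i+3)" x3 "v i"] adjs x5a x35 by (simp add: v_adj idx adj_sym)
qed

lemma W_Y_Y:
  "x \<in> W v \<Longrightarrow> y \<in> Y v i \<Longrightarrow> z \<in> Y v k \<Longrightarrow> k = i + 2 \<Longrightarrow> \<not> adj y z"
  using no_P5[of "v (i+1)" x "v (i+3)" y z] Y_W_anticomplete[of y i x] Y_W_anticomplete[of z k x]
    W_adj[of x] Y_adj[of y i] Y_adj[of z k]
  by (simp add: v_adj adj_sym)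

lemma A_A_Y_Y:
  "x \<in> A v i \<Longrightarrow> z \<in> A v j \<Longrightarrow> y \<in> Y v i \<Longrightarrow> w \<in> Y v j \<Longrightarrow> j = i + 1 \<Longrightarrow>
    \<not> (adj x w \<and> adj z y)"
  using no_HVN[of y w x z "v (i+3)"] A_A_complete[of x i z j] Y_Y_complete[of y i w j]
    A_Y_complete[of x i y] A_Y_complete[of z j w]
    A_adj[of x i] A_adj[of z j] Y_adj[of y i] Y_adj[of w j]
  by (simp add: v_adj adj_sym)

text \<open>Source of new cycles: relative to the new cycle other vertices change their type, which
  is how the hypothesis on all cycles is exploited.\<close>

lemma cyc_upd: assumes x: "x \<in> A v i" shows "cyc (v(i := x))"
  unfolding cyc_def
proof (intro allI)
  fix j k
  have "adj ((v(i := x)) j) ((v(i := x)) k) = adj (v j) (v k)"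
  proof (cases "j = i")
    case j: True
    show ?thesis
    proof (cases "k = i")
      case True then show ?thesis using j adj_irrefl by simp
    next
      case False then show ?thesis using j A_adj[OF x] v_adj[of i k] by simp
    qed
  next
    case j: False
    show ?thesis
    proof (cases "k = i")
      case True
      then show ?thesis using j A_adj[OF x] v_adj[of i j] adj_sym[of "v j" "v i"] by simp
    next
      case False then show ?thesis using j by simp
    qed
  qed
  then show "adj ((v(i := x)) j) ((v(i := x)) k) \<longleftrightarrow> k = j + 1 \<or> k = j + 4"
    unfolding v_adj .
qed

text \<open>Reversing the orientation exchanges \<open>i + 1\<close> with \<open>i + 4\<close> and
  \<open>i + 2\<close> with \<open>i + 3\<close>, while all types are preserved; every one-sided
  lemma thus has a mirrored version.\<close>

lemma cyc_mirror: "cyc (\<lambda>j. v (- j))"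
  by (auto simp: cyc_def v_adj minus_five_eq)

end

lemma A_mirror: "A (\<lambda>j. v (- j)) i = A v (- i)"
  unfolding A_def by (subst (2) all_five_minus) (auto simp: minus_five_eq)

lemma Y_mirror: "Y (\<lambda>j. v (- j)) i = Y v (- i)"
  unfolding Y_def by (subst (2) all_five_minus) (auto simp: minus_five_eq)

lemma F_mirror: "F (\<lambda>j. v (- j)) i = F v (- i)"
  unfolding F_def by (subst (2) all_five_minus) simp

lemma W_mirror: "W (\<lambda>j. v (- j)) = W v"
  unfolding W_def by (subst (2) all_five_minus) simp

lemma Y_disj:
  assumes "x \<in> Y v i" "x \<in> Y v j" shows "i = j"
proof (rule ccontr)
  assume "i \<noteq> j"
  then have "j = i+1 \<or> j = i+2 \<or> j = i+3 \<or> j = i+4" using five_cases[of j i] by auto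
  moreover have "(i = j \<or> i = j + 2 \<or> i = j + 3) \<and> (i+2 = j \<or> i+2 = j + 2 \<or> i+2 = j + 3) \<and>
      (i+3 = j \<or> i+3 = j + 2 \<or> i+3 = j + 3)"
    using assms unfolding Y_def by blast
  ultimately show False by (elim disjE) simp_all
qed

lemma A_Y_disj:
  assumes "x \<in> A v i" "x \<in> Y v j" shows False
proof -
  have "(j = i + 1 \<or> j = i + 4) \<and> (j + 2 = i + 1 \<or> j + 2 = i + 4) \<and> (j + 3 = i + 1 \<or> j + 3 = i + 4)"
    using assms unfolding A_def Y_def by blast
  then show False using five_cases[of j i] by (elim disjE) simp_all
qed

section \<open>Colouring the vertices of types A and Y\<close>

definition stable_set :: "'a set \<Rightarrow> bool" where
  "stable_set S \<longleftrightarrow> (\<forall>x\<in>S. \<forall>y\<in>S. \<not> adj x y)"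

definition AA :: "(5 \<Rightarrow> 'a) \<Rightarrow> 'a set" where "AA v = (\<Union>i. A v i)"

definition YY :: "(5 \<Rightarrow> 'a) \<Rightarrow> 'a set" where "YY v = (\<Union>i. Y v i)"

definition ZZ :: "(5 \<Rightarrow> 'a) \<Rightarrow> 'a set" where "ZZ v = W v \<union> (\<Union>i. F v i)"

text \<open>
  The last two conditions bound the number of colours seen by a component of \<open>D\<close>: the first one
  serves components with an edge, the second one isolated vertices.
\<close>

definition good_colouring :: "(5 \<Rightarrow> 'a) \<Rightarrow> ('a \<Rightarrow> nat) \<Rightarrow> bool" where
  "good_colouring v c \<longleftrightarrow>
    (\<forall>x \<in> AA v \<union> YY v. c x < 5) \<and>
    (\<forall>x \<in> AA v \<union> YY v. \<forall>y \<in> AA v \<union> YY v. adj x y \<longrightarrow> c x \<noteq> c y) \<and>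
    (\<forall>S \<subseteq> YY v. stable_set S \<longrightarrow> card (c ` S) \<le> 2) \<and>
    (\<forall>S \<subseteq> YY v. \<forall>z \<in> ZZ v. card (c ` S) \<ge> 5 \<longrightarrow>
      (\<exists>x\<in>S. \<exists>y\<in>S. adj x y \<and> adj z x \<and> adj z y))"

lemma AA_mirror: "AA (\<lambda>j. v (- j)) = AA v"
  unfolding AA_def A_mirror by (metis range_minus_five image_image)

lemma YY_mirror: "YY (\<lambda>j. v (- j)) = YY v"
  unfolding YY_def Y_mirror by (metis range_minus_five image_image)

lemma ZZ_mirror: "ZZ (\<lambda>j. v (- j)) = ZZ v"
  unfolding ZZ_def F_mirror W_mirror by (metis range_minus_five image_image)

lemma good_colouring_mirror: "good_colouring (\<lambda>j. v (- j)) c = good_colouring v c"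
  by (simp add: good_colouring_def AA_mirror YY_mirror ZZ_mirror)

section \<open>Mirrored constraints and the effect of bad vertices\<close>

context
  fixes v :: "5 \<Rightarrow> 'a"
  assumes cyc: "cyc v"
begin

lemma A_A_anticomplete_mirror:
  assumes "x \<in> A v j" "z \<in> A v k" "y \<in> Y v i" "j = i + 3" "k = i + 1" "adj x y = adj z y"
  shows "\<not> adj x z"
  using assms by (intro A_A_anticomplete[OF cyc_mirror[OF cyc], of x "- j" z "- k" y "- i"])
    (simp_all add: A_mirror Y_mirror minus_five_eq add.commute)

lemma A_not_both_mirror:
  assumes "x \<in> A v i" "y \<in> Y v j" "z \<in> Y v k" "j = i + 4" "k = i + 3"
  shows "\<not> (adj x y \<and> adj x z)"
  using assms by (intro A_not_both[OF cyc_mirror[OF cyc], of x "- i" y "- j" z "- k"])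
    (simp_all add: A_mirror Y_mirror minus_five_eq add.commute)

lemma A_Y_Y_dist3_mirror:
  assumes "x \<in> A v i" "y \<in> Y v j" "z \<in> Y v k" "j = i + 4" "k = i + 2" "adj x y"
  shows "adj x z \<noteq> adj y z"
  using assms by (intro A_Y_Y_dist3[OF cyc_mirror[OF cyc], of x "- i" y "- j" z "- k"])
    (simp_all add: A_mirror Y_mirror minus_five_eq add.commute)

lemma A_Y_Y_dist2_mirror:
  assumes "x \<in> A v i" "y \<in> Y v j" "z \<in> Y v k" "j = i + 4" "k = i + 1" "adj x y"
  shows "adj x z \<noteq> adj y z"
  using assms by (intro A_Y_Y_dist2[OF cyc_mirror[OF cyc], of x "- i" y "- j" z "- k"])
    (simp_all add: A_mirror Y_mirror minus_five_eq add.commute)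

text \<open>
  The vertex \<open>v i\<close> has no neighbour in \<open>Y v (i + 1)\<close> or \<open>Y v (i + 4)\<close>; the bad vertices of \<open>A v i\<close>
  are those that have one and so obstruct colouring \<open>A v i\<close> like one of these two sets.
\<close>

lemma bad_A_full:
  assumes x: "x \<in> A v i" and a: "a \<in> Y v i" and b: "b \<in> Y v j" and c: "c \<in> Y v k"
    and d: "d \<in> Y v l" and e: "e \<in> Y v m" and xb: "adj x b"
    and idx: "j = i + 1" "k = i + 2" "l = i + 3" "m = i + 4"
  shows "\<not> adj x c" "adj x d" "\<not> adj x e" "\<not> adj b d" "adj b e" "\<not> adj c e"
proof -
  have ix: "m = l + 1" "j = l + 3" "k = m + 3" "i = m + 1" "k = j + 1" "m = j + 3"
    by (simp_all add: idx)
  show xc: "\<not> adj x c" using A_not_both[OF cyc x b c] xb idx by blast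
  show xd: "adj x d"
  proof (rule ccontr)
    \<comment> \<open>From here the adjacencies are forced around the five classes until
      \<open>x\<close> misses both \<open>c\<close> and \<open>d\<close> and so does
      \<open>a\<close>, which gives an induced \<open>P5\<close> through \<open>a\<close>,
      \<open>x\<close>, \<open>v (i+4)\<close>.\<close>
    assume xd: "\<not> adj x d"
    then have bd: "adj b d" using A_Y_Y_dist3[OF cyc x b d] xb idx by blast
    then have be: "\<not> adj b e" using Y_no_common_neighbour[OF cyc d e b] ix adj_sym[of b d] adj_sym[of b e] by blast
    then have xe: "adj x e" using A_Y_Y_dist2[OF cyc x b e] xb idx by blast
    then have ec: "adj e c" using A_Y_Y_dist3_mirror[OF x e c] xc idx by blast
    have ad: "\<not> adj a d" using Y_no_common_neighbour[OF cyc a b d] bd idx by blast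
    have ac: "\<not> adj a c" using Y_no_common_neighbour[OF cyc e a c] ec ix by blast
    show False using A_Y_Y_Y[OF cyc x a c d] xc xd ad ac idx by blast
  qed
  show "\<not> adj b d" using A_Y_Y_dist3[OF cyc x b d] xb xd idx by blast
  show xe: "\<not> adj x e" using A_not_both_mirror[OF x e d] xd idx by blast
  show be: "adj b e" using A_Y_Y_dist2[OF cyc x b e] xb xe idx by blast
  show "\<not> adj c e" using Y_no_common_neighbour[OF cyc b c e] be ix by blast
qed

text \<open>By \<open>A_cover\<close> one of \<open>x\<close>, \<open>z\<close> sees
  \<open>b\<close>; but a vertex seeing \<open>c\<close>, respectively \<open>a\<close>, on its side
  cannot also see \<open>b\<close>.\<close>

lemma bad_A_A_three:
  assumes "x \<in> A v l" and "z \<in> A v m"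
    and "a \<in> Y v i" and "b \<in> Y v j" and "c \<in> Y v k"
    and "j = i + 1" "k = i + 2" "l = i + 3" "m = i + 4"
  shows "\<not> (adj x c \<and> adj z a)"
proof -
  have "k = l + 4" "j = l + 3" "i = m + 1" "j = m + 2" "l = j + 2" "m = j + 3"
    using assms by simp_all
  then show ?thesis
    using assms A_not_both_mirror[of x l c k b j] A_not_both[OF cyc, of z m a i b j]
      A_cover[OF cyc, of x l z m b j] by blast
qed

text \<open>An edge \<open>ad\<close> forces \<open>x\<close> to see \<open>d\<close>,
  \<open>z\<close> to see \<open>a\<close> and \<open>x\<close> to see \<open>z\<close>; then
  \<open>a\<close>, \<open>d\<close>, \<open>x\<close>, \<open>z\<close> are a \<open>K4\<close> in
  an HVN. This lets \<open>Y v i\<close> and \<open>Y v (i+3)\<close> share a colour.\<close>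

lemma bad_A_A_four:
  assumes x: "x \<in> A v i" and z: "z \<in> A v l"
    and a: "a \<in> Y v i" and b: "b \<in> Y v j" and c: "c \<in> Y v k" and d: "d \<in> Y v l"
    and xb: "adj x b" and zc: "adj z c" and idx: "j = i + 1" "k = i + 2" "l = i + 3"
  shows "\<not> adj a d"
proof
  assume ad: "adj a d"
  have ix: "l = k + 1" "i = k + 3" "k = l + 4" "i = l + 2" "j = l + 3" "l = j + 2" "i = j + 4"
    by (simp_all add: idx)
  have "\<not> adj b d" using Y_no_common_neighbour[OF cyc a b d] ad idx by blast
  then have xd: "adj x d" using A_Y_Y_dist3[OF cyc x b d] xb idx by blast
  have "\<not> adj c a" using Y_no_common_neighbour[OF cyc c d a] ad ix adj_sym[of a d] by blast
  then have za: "adj z a" using A_Y_Y_dist3_mirror[OF z c a] zc ix by blast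
  have "\<not> adj z b" using A_not_both_mirror[OF z c b] zc ix by blast
  then have "adj z x" using A_A_complete'[OF cyc z x b] xb ix by blast
  then have "adj x z" using adj_sym[of x z] by simp
  then show False using A_A_Y_Y_dist3[OF cyc x z a d] ad xd za idx by blast
qed

end

section \<open>Splitting classes, and colourings given by five stable sets\<close>

definition anti :: "'a set \<Rightarrow> 'a set \<Rightarrow> bool" where
  "anti S T \<longleftrightarrow> (\<forall>x\<in>S. \<forall>y\<in>T. \<not> adj x y)"

definition off :: "'a set \<Rightarrow> 'a set \<Rightarrow> 'a set" where
  "off S T = {x \<in> S. \<forall>y\<in>T. \<not> adj x y}"

lemma stable_Un: "stable_set (S \<union> T) \<longleftrightarrow> stable_set S \<and> stable_set T \<and> anti S T"
  unfolding stable_set_def anti_def using adj_sym by blast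

lemma anti_Un: "anti (S \<union> T) U \<longleftrightarrow> anti S U \<and> anti T U" "anti U (S \<union> T) \<longleftrightarrow> anti U S \<and> anti U T"
  unfolding anti_def by blast+

lemma anti_sym: "anti S T \<longleftrightarrow> anti T S"
  unfolding anti_def using adj_sym by blast

lemma anti_off: "anti (off S T) T" "anti T (off S T)"
  unfolding anti_def off_def using adj_sym by blast+

lemma stable_off: "stable_set S \<Longrightarrow> stable_set (off S T)"
  unfolding stable_set_def off_def by blast

lemma stable_Diff: "stable_set S \<Longrightarrow> stable_set (S - T)"
  unfolding stable_set_def by blast

text \<open>Quantified over all cycles, not only the current one, so that it also applies after a
  cycle vertex has been replaced.\<close>

definition no_consecutive :: bool where
  "no_consecutive \<longleftrightarrow> (\<forall>v i. cyc v \<longrightarrow> Y v i = {} \<or> Y v (i+1) = {})"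

text \<open>Taking the first match makes a cover by stable sets sufficient; the sets may overlap, as
  the split parts of a class usually do.\<close>

definition first5 :: "'a set \<Rightarrow> 'a set \<Rightarrow> 'a set \<Rightarrow> 'a set \<Rightarrow> 'a \<Rightarrow> nat" where
  "first5 S0 S1 S2 S3 x =
    (if x \<in> S0 then 0 else if x \<in> S1 then 1 else if x \<in> S2 then 2 else if x \<in> S3 then 3 else 4)"

context
  fixes v :: "5 \<Rightarrow> 'a"
  assumes cyc: "cyc v"
begin

lemma stable_A: "stable_set (A v i)"
  unfolding stable_set_def using A_stable[OF cyc] by blast

lemma stable_Y: "stable_set (Y v i)"
  unfolding stable_set_def using Y_stable[OF cyc] by blast

text \<open>Consecutive classes are complete to each other, so the indices of the classes met by
  \<open>S\<close> are themselves stable in the 5-cycle: at most two, and not consecutive.\<close>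

lemma stable_subset_YY:
  assumes S: "S \<subseteq> YY v" "stable_set S"
  shows "\<exists>j. S \<subseteq> Y v j \<union> Y v (j+2)"
proof (cases "S = {}")
  case False
  have no: "False" if "x \<in> S" "x \<in> Y v j" "y \<in> S" "y \<in> Y v k" "k = j + 1" for x y j k
    using that S(2) Y_Y_complete[OF cyc that(2) that(4,5)] unfolding stable_set_def by blast
  obtain x j where x: "x \<in> S" "x \<in> Y v j" using False S(1) unfolding YY_def by blast
  have sub: "y \<in> Y v j \<or> y \<in> Y v (j+2) \<or> y \<in> Y v (j+3)" if y: "y \<in> S" for y
  proof -
    obtain k where k: "y \<in> Y v k" using S(1) y unfolding YY_def by blast
    have "j = j + 4 + 1" by simp
    then have "k \<noteq> j + 1" "k \<noteq> j + 4" using no x y k by blast+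
    then show ?thesis using five_cases[of k j] k by blast
  qed
  have e: "j + 3 = j + 2 + 1" "j + 3 + 2 = j" by simp_all
  show ?thesis
  proof (cases "\<exists>y\<in>S. y \<in> Y v (j+2)")
    case True
    then have "S \<subseteq> Y v j \<union> Y v (j+2)" using sub no e(1) by blast
    then show ?thesis by blast
  next
    case False
    then have "S \<subseteq> Y v (j+3) \<union> Y v (j+3+2)" using sub unfolding e(2) by blast
    then show ?thesis by blast
  qed
qed blast

text \<open>\<open>K j\<close> bounds the colours on \<open>Y v j\<close>. By
  \<open>stable_subset_YY\<close> it is enough to count the colours on two classes at distance
  two.\<close>

lemma good_colouringI:
  assumes st: "stable_set S0" "stable_set S1" "stable_set S2" "stable_set S3" "stable_set S4"
    and cov: "AA v \<union> YY v \<subseteq> S0 \<union> S1 \<union> S2 \<union> S3 \<union> S4"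
    and K: "\<And>j x. x \<in> Y v j \<Longrightarrow> first5 S0 S1 S2 S3 x \<in> K j"
    and K2: "\<And>j. finite (K j)" "\<And>j. card (K j \<union> K (j+2)) \<le> 2"
    and P: "\<And>S z. S \<subseteq> YY v \<Longrightarrow> z \<in> ZZ v \<Longrightarrow> card (first5 S0 S1 S2 S3 ` S) \<ge> 5 \<Longrightarrow>
      \<exists>x\<in>S. \<exists>y\<in>S. adj x y \<and> adj z x \<and> adj z y"
  shows "good_colouring v (first5 S0 S1 S2 S3)"
  unfolding good_colouring_def
proof (intro conjI allI ballI impI)
  fix x show "first5 S0 S1 S2 S3 x < 5" by (simp add: first5_def)
next
  fix x y assume xy: "x \<in> AA v \<union> YY v" "y \<in> AA v \<union> YY v" "adj x y"
  show "first5 S0 S1 S2 S3 x \<noteq> first5 S0 S1 S2 S3 y"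
  proof
    assume eq: "first5 S0 S1 S2 S3 x = first5 S0 S1 S2 S3 y"
    have "x \<in> S0 \<and> y \<in> S0 \<or> x \<in> S1 \<and> y \<in> S1 \<or> x \<in> S2 \<and> y \<in> S2 \<or> x \<in> S3 \<and> y \<in> S3 \<or> x \<in> S4 \<and> y \<in> S4"
      using eq xy cov unfolding first5_def by (auto split: if_splits)
    then show False using st xy(3) unfolding stable_set_def by blast
  qed
next
  fix S assume "S \<subseteq> YY v" "stable_set S"
  then obtain j where "S \<subseteq> Y v j \<union> Y v (j+2)" using stable_subset_YY by blast
  then have "first5 S0 S1 S2 S3 ` S \<subseteq> K j \<union> K (j+2)" using K by blast
  then have "card (first5 S0 S1 S2 S3 ` S) \<le> card (K j \<union> K (j+2))"
    using K2(1) by (intro card_mono) simp_all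
  then show "card (first5 S0 S1 S2 S3 ` S) \<le> 2" using K2(2) le_trans by blast
next
  fix S z assume "S \<subseteq> YY v" "z \<in> ZZ v" "5 \<le> card (first5 S0 S1 S2 S3 ` S)"
  then show "\<exists>x\<in>S. \<exists>y\<in>S. adj x y \<and> adj z x \<and> adj z y" by (rule P)
qed

text \<open>Here at most four colours occur on type \<open>Y\<close>, so the last condition of
  \<open>good_colouring\<close> holds vacuously.\<close>

lemma good_colouringI':
  assumes st: "stable_set S0" "stable_set S1" "stable_set S2" "stable_set S3" "stable_set S4"
    and cov: "AA v \<union> YY v \<subseteq> S0 \<union> S1 \<union> S2 \<union> S3 \<union> S4"
    and K: "first5 S0 S1 S2 S3 ` Y v i \<subseteq> K0" "first5 S0 S1 S2 S3 ` Y v (i+1) \<subseteq> K1"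
      "first5 S0 S1 S2 S3 ` Y v (i+2) \<subseteq> K2" "first5 S0 S1 S2 S3 ` Y v (i+3) \<subseteq> K3"
      "first5 S0 S1 S2 S3 ` Y v (i+4) \<subseteq> K4"
    and T: "K0 \<union> K1 \<union> K2 \<union> K3 \<union> K4 \<subseteq> T" "finite T" "card T \<le> 4"
    and card2: "card (K0 \<union> K2) \<le> 2" "card (K1 \<union> K3) \<le> 2" "card (K2 \<union> K4) \<le> 2"
      "card (K3 \<union> K0) \<le> 2" "card (K4 \<union> K1) \<le> 2"
  shows "good_colouring v (first5 S0 S1 S2 S3)"
proof -
  define K where "K j = (if j = i then K0 else if j = i+1 then K1 else if j = i+2 then K2
    else if j = i+3 then K3 else K4)" for j
  have Ks: "K i = K0" "K (i+1) = K1" "K (i+2) = K2" "K (i+3) = K3" "K (i+4) = K4"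
    by (simp_all add: K_def)
  have e: "i+1+2 = i+3" "i+2+2 = i+4" "i+3+2 = i" "i+4+2 = i+1" by simp_all
  have KY: "first5 S0 S1 S2 S3 x \<in> K j" if "x \<in> Y v j" for j x
  proof -
    consider "j = i" | "j = i+1" | "j = i+2" | "j = i+3" | "j = i+4" using five_cases[of j i] by blast
    then show ?thesis using K that by cases (auto simp only: Ks)
  qed
  have KU: "K j \<subseteq> K0 \<union> K1 \<union> K2 \<union> K3 \<union> K4" for j by (auto simp: K_def)
  show ?thesis
  proof (rule good_colouringI[where K = K])
    show "finite (K j)" for j using finite_subset[OF KU finite_subset[OF T(1,2)]] .
    show "card (K j \<union> K (j+2)) \<le> 2" for j
    proof -
      consider "j = i" | "j = i+1" | "j = i+2" | "j = i+3" | "j = i+4" using five_cases[of j i] by blast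
      then show ?thesis using card2 by cases (simp_all only: Ks e)
    qed
    fix S z assume S: "S \<subseteq> YY v" "card (first5 S0 S1 S2 S3 ` S) \<ge> 5"
    have "first5 S0 S1 S2 S3 ` S \<subseteq> K0 \<union> K1 \<union> K2 \<union> K3 \<union> K4"
      using S(1) KY KU unfolding YY_def by blast
    then have "card (first5 S0 S1 S2 S3 ` S) \<le> card T" by (intro card_mono T(2) order_trans[OF _ T(1)])
    then have "card (first5 S0 S1 S2 S3 ` S) \<le> 4" using T(3) by simp
    then show "\<exists>x\<in>S. \<exists>y\<in>S. adj x y \<and> adj z x \<and> adj z y" using S(2) by simp
  qed (use st cov KY in auto)
qed

text \<open>Vertices of both parts agree on \<open>y\<close> because both miss it, so
  \<open>A_A_anticomplete\<close> applies. This is where non-emptiness of \<open>Y v i\<close>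
  enters.\<close>

lemma anti_off_A_A:
  assumes "y \<in> Y v i" "j = i + 2 \<and> k = i + 4 \<or> j = i + 3 \<and> k = i + 1"
  shows "anti (off (A v j) (Y v i)) (off (A v k) (Y v i))"
  unfolding anti_def off_def
  using A_A_anticomplete[OF cyc, of _ j _ k y i] A_A_anticomplete_mirror[OF cyc, of _ j _ k y i] assms
  by blast

text \<open>The vertex \<open>y\<close> would have to see exactly one end of an edge between the
  parts, but both parts miss it.\<close>

lemma anti_off_A_Y:
  assumes "y \<in> Y v i"
    and "j = k + 1 \<and> (i = k + 3 \<or> i = k + 4) \<or> j = k + 4 \<and> (i = k + 2 \<or> i = k + 1)"
  shows "anti (off (A v k) (Y v i)) (off (Y v j) (Y v i))"
  unfolding anti_def off_def
proof (intro ballI notI; clarify)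
  fix x z assume x: "x \<in> A v k" and z: "z \<in> Y v j" and xz: "adj x z"
    and n: "\<forall>y\<in>Y v i. \<not> adj x y" "\<forall>y\<in>Y v i. \<not> adj z y"
  have "adj x y \<noteq> adj z y"
    using A_Y_Y_dist3[OF cyc x z assms(1)] A_Y_Y_dist2[OF cyc x z assms(1)]
      A_Y_Y_dist3_mirror[OF cyc x z assms(1)] A_Y_Y_dist2_mirror[OF cyc x z assms(1)] xz assms(2)
    by blast
  then show False using n assms(1) by blast
qed

lemma A_subset_off:
  assumes "j = k + 1" "l = k + 2"
  shows "A v k \<subseteq> off (A v k) (Y v j) \<union> off (A v k) (Y v l)"
  unfolding off_def using A_not_both[OF cyc, of _ k _ j _ l, OF _ _ _ assms] by blast

lemma A_subset_off_mirror:
  assumes "j = k + 4" "l = k + 3"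
  shows "A v k \<subseteq> off (A v k) (Y v j) \<union> off (A v k) (Y v l)"
  unfolding off_def using A_not_both_mirror[OF cyc, of _ k _ j _ l, OF _ _ _ assms] by blast

lemma Y_subset_off:
  assumes "j = k + 1" "l = k + 3"
  shows "Y v l \<subseteq> off (Y v l) (Y v k) \<union> off (Y v l) (Y v j)"
  unfolding off_def
  using Y_no_common_neighbour[OF cyc, of _ k _ j _ l] assms adj_sym by blast

lemma AA_YY_subset:
  assumes "A v i \<subseteq> T" "A v (i+1) \<subseteq> T" "A v (i+2) \<subseteq> T" "A v (i+3) \<subseteq> T" "A v (i+4) \<subseteq> T"
    "Y v i \<subseteq> T" "Y v (i+1) \<subseteq> T" "Y v (i+2) \<subseteq> T" "Y v (i+3) \<subseteq> T" "Y v (i+4) \<subseteq> T"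
  shows "AA v \<union> YY v \<subseteq> T"
  unfolding AA_def YY_def
proof (intro Un_least UN_least)
  fix j show "A v j \<subseteq> T" using five_cases[of j i] assms by (elim disjE) simp_all
next
  fix j show "Y v j \<subseteq> T" using five_cases[of j i] assms by (elim disjE) simp_all
qed

lemma Y_mem: "x \<in> Y v i \<Longrightarrow> x \<in> Y v j \<longleftrightarrow> j = i" "x \<in> Y v i \<Longrightarrow> x \<notin> A v j"
  using Y_disj A_Y_disj by blast+

lemma Y_image:
  assumes "\<And>x. x \<in> Y v j \<Longrightarrow> \<forall>k. x \<in> Y v k \<longleftrightarrow> k = j \<Longrightarrow> \<forall>k. x \<notin> A v k \<Longrightarrow> c x = n"
  shows "c ` Y v j \<subseteq> {n}"
  using assms Y_mem by blast

lemma first5_01: "x \<in> S0 \<union> S1 \<Longrightarrow> first5 S0 S1 S2 S3 x \<in> {0,1}"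
  unfolding first5_def by auto

section \<open>Two consecutive non-empty classes Y and at least one empty class\<close>

lemma good_two_consecutive:
  assumes y: "y \<in> Y v i" "y' \<in> Y v (i+1)" and e: "Y v (i+4) = {}"
    and an: "anti (A v (i+3)) (Y v (i+2))"
  shows "\<exists>c. good_colouring v c"
proof -
  \<comment> \<open>No vertex of \<open>A v (i+4)\<close>, \<open>A v (i+2)\<close> or
    \<open>Y v (i+3)\<close> has neighbours in both \<open>Y v i\<close> and
    \<open>Y v (i+1)\<close>, so these three classes are divided between colours 0 and 1.\<close>
  let ?S0 = "Y v i \<union> off (A v (i+4)) (Y v i) \<union> off (A v (i+2)) (Y v i) \<union> off (Y v (i+3)) (Y v i)"
  let ?S1 = "Y v (i+1) \<union> off (A v (i+4)) (Y v (i+1)) \<union> off (A v (i+2)) (Y v (i+1))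
    \<union> off (Y v (i+3)) (Y v (i+1))"
  let ?S4 = "A v (i+3) \<union> Y v (i+2)"
  have cov: "A v (i+4) \<subseteq> ?S0 \<union> ?S1" "A v (i+2) \<subseteq> ?S0 \<union> ?S1" "Y v (i+3) \<subseteq> ?S0 \<union> ?S1"
  proof -
    have "A v (i+4) \<subseteq> off (A v (i+4)) (Y v i) \<union> off (A v (i+4)) (Y v (i+1))"
      by (rule A_subset_off) simp_all
    then show "A v (i+4) \<subseteq> ?S0 \<union> ?S1" by blast
    have "A v (i+2) \<subseteq> off (A v (i+2)) (Y v (i+1)) \<union> off (A v (i+2)) (Y v i)"
      by (rule A_subset_off_mirror) simp_all
    then show "A v (i+2) \<subseteq> ?S0 \<union> ?S1" by blast
    have "Y v (i+3) \<subseteq> off (Y v (i+3)) (Y v i) \<union> off (Y v (i+3)) (Y v (i+1))"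
      by (rule Y_subset_off[OF refl refl])
    then show "Y v (i+3) \<subseteq> ?S0 \<union> ?S1" by blast
  qed
  have an0: "anti (off (A v (i+4)) (Y v i)) (off (A v (i+2)) (Y v i))"
    "anti (off (A v (i+4)) (Y v i)) (off (Y v (i+3)) (Y v i))"
    "anti (off (A v (i+2)) (Y v i)) (off (Y v (i+3)) (Y v i))"
    by (subst anti_sym, rule anti_off_A_A[OF y(1)], simp) (rule anti_off_A_Y[OF y(1)], simp)+
  have an1: "anti (off (A v (i+4)) (Y v (i+1))) (off (A v (i+2)) (Y v (i+1)))"
    "anti (off (A v (i+4)) (Y v (i+1))) (off (Y v (i+3)) (Y v (i+1)))"
    "anti (off (A v (i+2)) (Y v (i+1))) (off (Y v (i+3)) (Y v (i+1)))"
    by (rule anti_off_A_A[OF y(2)], simp) (rule anti_off_A_Y[OF y(2)], simp)+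
  \<comment> \<open>Colours 2 and 3 are left to \<open>A v i\<close> and \<open>A v (i+1)\<close>.
    Only \<open>Y v (i+3)\<close> is split between two colours, and the classes at distance two from
    it are empty or use one of these two.\<close>
  have "good_colouring v (first5 ?S0 ?S1 (A v i) (A v (i+1)))"
  proof (rule good_colouringI'[where ?S4.0 = ?S4 and i = i and T = "{0,1,4}" and ?K0.0 = "{0}" and ?K1.0 = "{1}"
        and ?K2.0 = "{4}" and ?K3.0 = "{0,1}" and ?K4.0 = "{}"])
    show "stable_set ?S0" "stable_set ?S1" "stable_set ?S4"
      using an0 an1 an by (simp_all add: stable_Un anti_Un stable_A stable_Y stable_off anti_off)
    show "AA v \<union> YY v \<subseteq> ?S0 \<union> ?S1 \<union> A v i \<union> A v (i+1) \<union> ?S4"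
    proof (rule AA_YY_subset[of i])
      show "A v (i+4) \<subseteq> ?S0 \<union> ?S1 \<union> A v i \<union> A v (i+1) \<union> ?S4" using cov(1) by (rule le_supI1[OF le_supI1[OF le_supI1]])
      show "A v (i+2) \<subseteq> ?S0 \<union> ?S1 \<union> A v i \<union> A v (i+1) \<union> ?S4" using cov(2) by (rule le_supI1[OF le_supI1[OF le_supI1]])
      show "Y v (i+3) \<subseteq> ?S0 \<union> ?S1 \<union> A v i \<union> A v (i+1) \<union> ?S4" using cov(3) by (rule le_supI1[OF le_supI1[OF le_supI1]])
      show "Y v (i+4) \<subseteq> ?S0 \<union> ?S1 \<union> A v i \<union> A v (i+1) \<union> ?S4" by (simp only: e empty_subsetI)
    qed blast+
    show "first5 ?S0 ?S1 (A v i) (A v (i+1)) ` Y v (i+3) \<subseteq> {0,1}"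
      by (intro image_subsetI first5_01 subsetD[OF cov(3)])
    show "first5 ?S0 ?S1 (A v i) (A v (i+1)) ` Y v i \<subseteq> {0}"
      unfolding first5_def by auto
    show "first5 ?S0 ?S1 (A v i) (A v (i+1)) ` Y v (i+1) \<subseteq> {1}"
      by (rule Y_image) (simp add: first5_def off_def)
    show "first5 ?S0 ?S1 (A v i) (A v (i+1)) ` Y v (i+2) \<subseteq> {4}"
      by (rule Y_image) (simp add: first5_def off_def)
    show "first5 ?S0 ?S1 (A v i) (A v (i+1)) ` Y v (i+4) \<subseteq> {}"
      unfolding e by simp
  qed (simp_all add: stable_A)
  then show ?thesis by blast
qed

end

context
  fixes v :: "5 \<Rightarrow> 'a"
  assumes cyc: "cyc v"
begin

lemma good_two_consecutive_mirror:
  assumes y: "y \<in> Y v i" "y' \<in> Y v j" and e: "Y v m = {}"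
    and an: "anti (A v l) (Y v k)" and idx: "j = i + 4" "k = i + 3" "l = i + 2" "m = i + 1"
  shows "\<exists>c. good_colouring v c"
proof -
  have "\<exists>c. good_colouring (\<lambda>j. v (- j)) c"
  proof (rule good_two_consecutive[OF cyc_mirror[OF cyc], of y "- i" y'])
    have ix: "- (- i + 1) = j" "- (- i + 2) = k" "- (- i + 3) = l" "- (- i + 4) = m"
      by (simp_all add: idx minus_five_eq)
    show "y \<in> Y (\<lambda>j. v (- j)) (- i)" "y' \<in> Y (\<lambda>j. v (- j)) (- i + 1)"
      "Y (\<lambda>j. v (- j)) (- i + 4) = {}" "anti (A (\<lambda>j. v (- j)) (- i + 3)) (Y (\<lambda>j. v (- j)) (- i + 2))"
      unfolding Y_mirror A_mirror ix using y e an by simp_all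
  qed
  then show ?thesis by (simp add: good_colouring_mirror)
qed

text \<open>The two bad vertices \<open>x\<close> and \<open>z\<close>, one at each end of the run
  of four classes, make \<open>Y v i\<close>, \<open>Y v (i+3)\<close> and \<open>A v (i+4)\<close>
  pairwise anticomplete; \<open>A v i\<close> and \<open>A v (i+3)\<close> are divided between the
  colours of the two middle classes.\<close>

lemma good_four:
  assumes a: "a \<in> Y v i" and b: "b \<in> Y v (i+1)" and c: "c \<in> Y v (i+2)" and d: "d \<in> Y v (i+3)"
    and e: "Y v (i+4) = {}"
    and x: "x \<in> A v i" "adj x b" and z: "z \<in> A v (i+3)" "adj z c"
  shows "\<exists>c. good_colouring v c"
proof -
  let ?S0 = "Y v i \<union> Y v (i+3) \<union> A v (i+4)"
  let ?S1 = "Y v (i+1) \<union> off (A v (i+3)) (Y v (i+1)) \<union> off (A v i) (Y v (i+1))"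
  let ?S2 = "Y v (i+2) \<union> off (A v (i+3)) (Y v (i+2)) \<union> off (A v i) (Y v (i+2))"
  have cov: "A v (i+3) \<subseteq> ?S0 \<union> ?S1 \<union> ?S2" "A v i \<subseteq> ?S0 \<union> ?S1 \<union> ?S2"
  proof -
    have "A v (i+3) \<subseteq> off (A v (i+3)) (Y v (i+2)) \<union> off (A v (i+3)) (Y v (i+1))"
      by (rule A_subset_off_mirror[OF cyc]) simp_all
    then show "A v (i+3) \<subseteq> ?S0 \<union> ?S1 \<union> ?S2" by blast
    have "A v i \<subseteq> off (A v i) (Y v (i+1)) \<union> off (A v i) (Y v (i+2))"
      by (rule A_subset_off[OF cyc]) simp_all
    then show "A v i \<subseteq> ?S0 \<union> ?S1 \<union> ?S2" by blast
  qed
  have an0: "anti (Y v i) (Y v (i+3))"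
    unfolding anti_def using bad_A_A_four[OF cyc x(1) z(1) _ b c _ x(2) z(2)] by blast
  have ix: "i + 2 = i + 4 + 3" "i + 3 = i + 4 + 4" "i = i + 2 + 3" "i + 4 = i + 2 + 2" by simp_all
  \<comment> \<open>This and the next claim are the argument of \<open>bad_A_A_three\<close>, once
    from \<open>z\<close> and once mirrored from \<open>x\<close>.\<close>
  have an1: "anti (Y v i) (A v (i+4))"
    unfolding anti_def using bad_A_A_three[OF cyc z(1) _ _ b c] z(2) adj_sym by blast
  have an2: "anti (Y v (i+3)) (A v (i+4))"
    unfolding anti_def
  proof (intro ballI notI)
    fix d' w assume d': "d' \<in> Y v (i+3)" and w: "w \<in> A v (i+4)" and "adj d' w"
    then have "\<not> adj w c" using A_not_both_mirror[OF cyc w d' c ix(2,1)] adj_sym[of w d'] by blast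
    moreover have "\<not> adj x c" using A_not_both[OF cyc x(1) b c] x(2) by blast
    ultimately show False using A_cover[OF cyc w x(1) c ix(4,3)] by blast
  qed
  have an3: "anti (off (A v (i+3)) (Y v (i+1))) (off (A v i) (Y v (i+1)))"
    by (rule anti_off_A_A[OF cyc b]) simp
  have an4: "anti (off (A v (i+3)) (Y v (i+2))) (off (A v i) (Y v (i+2)))"
    by (subst anti_sym, rule anti_off_A_A[OF cyc c]) simp
  have "good_colouring v (first5 ?S0 ?S1 ?S2 (A v (i+1)))"
  proof (rule good_colouringI'[OF cyc, where ?S4.0 = "A v (i+2)" and i = i and T = "{0,1,2}" and ?K0.0 = "{0}" and ?K1.0 = "{1}"
        and ?K2.0 = "{2}" and ?K3.0 = "{0}" and ?K4.0 = "{}"])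
    show "stable_set ?S0" "stable_set ?S1" "stable_set ?S2"
      using an0 an1 an2 an3 an4
      by (simp_all add: stable_Un anti_Un stable_A[OF cyc] stable_Y[OF cyc] stable_off anti_off)
    show "AA v \<union> YY v \<subseteq> ?S0 \<union> ?S1 \<union> ?S2 \<union> A v (i+1) \<union> A v (i+2)"
    proof (rule AA_YY_subset[OF cyc, of i])
      show "A v (i+3) \<subseteq> ?S0 \<union> ?S1 \<union> ?S2 \<union> A v (i+1) \<union> A v (i+2)" using cov(1) by (rule le_supI1[OF le_supI1])
      show "A v i \<subseteq> ?S0 \<union> ?S1 \<union> ?S2 \<union> A v (i+1) \<union> A v (i+2)" using cov(2) by (rule le_supI1[OF le_supI1])
      show "Y v (i+4) \<subseteq> ?S0 \<union> ?S1 \<union> ?S2 \<union> A v (i+1) \<union> A v (i+2)" by (simp only: e empty_subsetI)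
    qed blast+
    show "first5 ?S0 ?S1 ?S2 (A v (i+1)) ` Y v i \<subseteq> {0}" by (rule Y_image[OF cyc]) (simp add: first5_def off_def)
    show "first5 ?S0 ?S1 ?S2 (A v (i+1)) ` Y v (i+1) \<subseteq> {1}" by (rule Y_image[OF cyc]) (simp add: first5_def off_def)
    show "first5 ?S0 ?S1 ?S2 (A v (i+1)) ` Y v (i+2) \<subseteq> {2}" by (rule Y_image[OF cyc]) (simp add: first5_def off_def)
    show "first5 ?S0 ?S1 ?S2 (A v (i+1)) ` Y v (i+3) \<subseteq> {0}" by (rule Y_image[OF cyc]) (simp add: first5_def off_def)
    show "first5 ?S0 ?S1 ?S2 (A v (i+1)) ` Y v (i+4) \<subseteq> {}" unfolding e by simp
  qed (simp_all add: stable_A[OF cyc])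
  then show ?thesis by blast
qed

section \<open>All five classes Y non-empty\<close>

lemma bad_A_full_mirror:
  assumes x: "x \<in> A v i" and a: "a \<in> Y v i" and b: "b \<in> Y v j" and c: "c \<in> Y v k"
    and d: "d \<in> Y v l" and e: "e \<in> Y v m" and xb: "adj x b"
    and idx: "j = i + 4" "k = i + 3" "l = i + 2" "m = i + 1"
  shows "adj b e"
proof -
  have ix: "- j = - i + 1" "- k = - i + 2" "- l = - i + 3" "- m = - i + 4"
    by (simp_all add: idx minus_five_eq)
  note * = A_mirror[of v "- i"] Y_mirror[of v "- i"] Y_mirror[of v "- j"] Y_mirror[of v "- k"]
    Y_mirror[of v "- l"] Y_mirror[of v "- m"]
  show ?thesis
    by (rule bad_A_full(5)[OF cyc_mirror[OF cyc] _ _ _ _ _ _ xb ix])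
      (use x a b c d e in \<open>simp_all only: * minus_minus\<close>)
qed

text \<open>A single bad vertex forces \<open>Y v (i+2)\<close> and \<open>Y v (i+4)\<close> to be
  anticomplete, so they share a colour. The bad part of \<open>A v i\<close> and the whole of
  \<open>A v (i+3)\<close> miss both classes and join them, which makes room for the rest.\<close>

lemma good_full_bad:
  assumes a: "a \<in> Y v i" and b: "b \<in> Y v (i+1)" and c: "c \<in> Y v (i+2)" and d: "d \<in> Y v (i+3)"
    and e: "e \<in> Y v (i+4)" and x: "x \<in> A v i" "adj x b"
  shows "\<exists>c. good_colouring v c"
proof -
  let ?B = "A v i - off (A v i) (Y v (i+1))"
  let ?S0 = "Y v (i+2) \<union> Y v (i+4) \<union> A v (i+3) \<union> ?B"
  let ?S1 = "Y v (i+1) \<union> off (A v i) (Y v (i+1))"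
  let ?S2 = "Y v i \<union> A v (i+1)"
  let ?S3 = "Y v (i+3) \<union> A v (i+2)"
  note full = bad_A_full[OF cyc _ _ _ _ _ _ _ refl refl refl refl]
  have ix: "i + 1 = i + 3 + 3" "i = i + 3 + 2" "i = i + 2 + 3" "i + 1 = i + 2 + 4"
    "i + 3 = i + 2 + 1" "i + 4 = i + 2 + 2" "i + 4 = i + 3 + 1" "i + 2 = i + 3 + 4" by simp_all
  have ce: "\<not> adj c' e'" if "c' \<in> Y v (i+2)" "e' \<in> Y v (i+4)" for c' e'
    using full(6)[OF x(1) a b that(1) d that(2) x(2)] .
  have bd: "\<not> adj b d'" if "d' \<in> Y v (i+3)" for d'
    using full(4)[OF x(1) a b c that e x(2)] .
  have be: "adj b e" using full(5)[OF x(1) a b c d e x(2)] .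
  have B: "\<not> adj x' c'" "\<not> adj x' e'" if x': "x' \<in> ?B" and c': "c' \<in> Y v (i+2)" and e': "e' \<in> Y v (i+4)" for x' c' e'
  proof -
    obtain b' where b': "b' \<in> Y v (i+1)" "adj x' b'" "x' \<in> A v i"
      using x' unfolding off_def by blast
    show "\<not> adj x' c'" using full(1)[OF b'(3) a b'(1) c' d e' b'(2)] .
    show "\<not> adj x' e'" using full(3)[OF b'(3) a b'(1) c' d e' b'(2)] .
  qed
  have A2: "anti (Y v i) (A v (i+1))"
    unfolding anti_def using A_A_Y_Y[OF cyc x(1) _ _ b refl] x(2) adj_sym by blast
  have A3: "anti (Y v (i+3)) (A v (i+2))"
    unfolding anti_def
  proof (intro ballI notI)
    fix d' w assume d': "d' \<in> Y v (i+3)" and w: "w \<in> A v (i+2)" and "adj d' w"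
    then have "adj w d'" using adj_sym[of w d'] by simp
    then have "adj d' b" by (rule bad_A_full(5)[OF cyc w c d' e a b _ ix(5,6,3,4)])
    then show False using bd[OF d'] adj_sym[of b d'] by simp
  qed
  have A4: "\<not> adj w c'" "\<not> adj w e'" if "w \<in> A v (i+3)" "c' \<in> Y v (i+2)" "e' \<in> Y v (i+4)" for w c' e'
  proof -
    show "\<not> adj w c'"
    proof
      assume "adj w c'"
      then have "adj c' e'"
        by (rule bad_A_full_mirror[OF that(1) d that(2) b a that(3) _ ix(8,1,2,7)])
      then show False using ce that by blast
    qed
    show "\<not> adj w e'"
    proof
      assume "adj w e'"
      then have "adj e' c'"
        by (rule bad_A_full(5)[OF cyc that(1) d that(3) a b that(2) _ ix(7,2,1,8)])
      then show False using ce[OF that(2,3)] adj_sym[of c' e'] by simp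
    qed
  qed
  \<comment> \<open>Both vertices miss \<open>c\<close>, so they agree on it and cannot be
    adjacent.\<close>
  have "\<not> adj w x'" if "w \<in> A v (i+3)" "x' \<in> ?B" for w x'
    using A_A_anticomplete_mirror[OF cyc _ that(1) c ix(3,5), of x'] A4[OF that(1) c e] B[OF that(2) c e]
      that(2) adj_sym[of w x'] by blast
  then have "stable_set ?S0"
    using ce A4(1)[OF _ _ e] A4(2)[OF _ c] B(1)[OF _ _ e] B(2)[OF _ c] anti_sym[of "Y v _" "A v (i+3)"]
      anti_sym[of "Y v _" ?B]
    unfolding stable_Un anti_Un
    by (simp add: stable_A[OF cyc] stable_Y[OF cyc] stable_Diff anti_def)
  have "good_colouring v (first5 ?S0 ?S1 ?S2 ?S3)"
  proof (rule good_colouringI'[OF cyc, where ?S4.0 = "A v (i+4)" and i = i and T = "{0,1,2,3}" and ?K0.0 = "{2}"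
        and ?K1.0 = "{1}" and ?K2.0 = "{0}" and ?K3.0 = "{3}" and ?K4.0 = "{0}"])
    show "stable_set ?S0" by fact
    show "stable_set ?S1" "stable_set ?S2" "stable_set ?S3"
      using A2 A3
      by (simp_all add: stable_Un anti_Un stable_A[OF cyc] stable_Y[OF cyc] stable_off anti_off)
    show "AA v \<union> YY v \<subseteq> ?S0 \<union> ?S1 \<union> ?S2 \<union> ?S3 \<union> A v (i+4)"
      by (rule AA_YY_subset[OF cyc, of i]) blast+
    show "first5 ?S0 ?S1 ?S2 ?S3 ` Y v i \<subseteq> {2}" by (rule Y_image[OF cyc]) (simp add: first5_def off_def)
    show "first5 ?S0 ?S1 ?S2 ?S3 ` Y v (i+1) \<subseteq> {1}" by (rule Y_image[OF cyc]) (simp add: first5_def off_def)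
    show "first5 ?S0 ?S1 ?S2 ?S3 ` Y v (i+2) \<subseteq> {0}" by (rule Y_image[OF cyc]) (simp add: first5_def off_def)
    show "first5 ?S0 ?S1 ?S2 ?S3 ` Y v (i+3) \<subseteq> {3}" by (rule Y_image[OF cyc]) (simp add: first5_def off_def)
    show "first5 ?S0 ?S1 ?S2 ?S3 ` Y v (i+4) \<subseteq> {0}" by (rule Y_image[OF cyc]) (simp add: first5_def off_def)
  qed (simp_all add: stable_A[OF cyc])
  then show ?thesis by blast
qed

lemma F_Y_complete_mirror:
  assumes "x \<in> F v i" "y \<in> Y v (i+3)" shows "adj x y"
proof -
  have "- (- i + 2) = i + 3" by (simp add: minus_five_eq)
  then show ?thesis
    using F_Y_complete[OF cyc_mirror[OF cyc], of x "- i" y] assms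
    unfolding F_mirror Y_mirror by (simp only: minus_minus)
qed

text \<open>A vertex of \<open>W v\<close> makes classes \<open>Y\<close> at distance two
  anticomplete. A bad vertex of \<open>A v j\<close> would create an edge between
  \<open>Y v (j+1)\<close> and \<open>Y v (j+4)\<close>, so there is none on either side. Hence
  \<open>Y v 0\<close>, \<open>Y v 2\<close> and \<open>A v 1\<close> can share a colour. Four
  colours on type \<open>Y\<close> are essential here, since \<open>W v\<close> is anticomplete to
  it.\<close>

lemma good_full_W:
  assumes ne: "\<And>j. Y v j \<noteq> {}" and w: "w \<in> W v"
  shows "\<exists>c. good_colouring v c"
proof -
  have YY: "\<not> adj y z" if "y \<in> Y v j" "z \<in> Y v (j+2)" for j y z
    using W_Y_Y[OF cyc w that] by simp
  have up: "\<not> adj x b" if "x \<in> A v j" "b \<in> Y v (j+1)" for j x b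
  proof
    assume xb: "adj x b"
    obtain a c d e where "a \<in> Y v j" "c \<in> Y v (j+2)" "d \<in> Y v (j+3)" and e: "e \<in> Y v (j+4)"
      using ne[of j] ne[of "j+2"] ne[of "j+3"] ne[of "j+4"] by blast
    then have "adj b e" using bad_A_full(5)[OF cyc that(1) _ that(2) _ _ _ xb] by blast
    moreover have "j + 1 = j + 4 + 2" by simp
    then have "\<not> adj e b" by (rule W_Y_Y[OF cyc w e that(2)])
    ultimately show False using adj_sym[of b e] by simp
  qed
  have down: "\<not> adj x b" if "x \<in> A v j" "b \<in> Y v (j+4)" for j x b
  proof
    assume xb: "adj x b"
    obtain a c d e where "a \<in> Y v j" "c \<in> Y v (j+3)" "d \<in> Y v (j+2)" and e: "e \<in> Y v (j+1)"
      using ne[of j] ne[of "j+3"] ne[of "j+2"] ne[of "j+1"] by blast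
    then have "adj b e" using bad_A_full_mirror[OF that(1) _ that(2) _ _ _ xb] by blast
    moreover have "j + 1 = j + 4 + 2" by simp
    then have "\<not> adj b e" by (rule W_Y_Y[OF cyc w that(2) e])
    ultimately show False by simp
  qed
  have ix: "(1::5) + 1 = 2" "(1::5) + 4 = 0" "(2::5) + 1 = 3" "(3::5) + 1 = 4" "(0::5) + 1 = 1" by simp_all
  have an: "anti (Y v 0) (Y v 2)" "anti (Y v 0) (A v 1)" "anti (Y v 2) (A v 1)" "anti (Y v 1) (A v 0)"
    "anti (Y v 3) (A v 2)" "anti (Y v 4) (A v 3)"
    unfolding anti_def
    using YY[of _ 0] down[of _ 1] up[of _ 1] up[of _ 0] up[of _ 2] up[of _ 3] adj_sym
    unfolding ix add_0 by blast+
  have "good_colouring v (first5 (Y v 0 \<union> Y v 2 \<union> A v 1) (Y v 1 \<union> A v 0) (Y v 3 \<union> A v 2) (Y v 4 \<union> A v 3))"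
    (is "good_colouring v ?c")
  proof (rule good_colouringI'[OF cyc, where ?S4.0 = "A v 4" and i = 0 and T = "{0,1,2,3}" and ?K0.0 = "{0}"
        and ?K1.0 = "{1}" and ?K2.0 = "{0}" and ?K3.0 = "{2}" and ?K4.0 = "{3}"])
    show "AA v \<union> YY v \<subseteq> Y v 0 \<union> Y v 2 \<union> A v 1 \<union> (Y v 1 \<union> A v 0) \<union> (Y v 3 \<union> A v 2) \<union> (Y v 4 \<union> A v 3) \<union> A v 4"
      by (rule AA_YY_subset[OF cyc, of 0]) auto
    show "?c ` Y v 0 \<subseteq> {0}" by (rule Y_image[OF cyc]) (simp add: first5_def off_def)
    show "?c ` Y v (0+1) \<subseteq> {1}" by (rule Y_image[OF cyc]) (simp add: first5_def off_def)
    show "?c ` Y v (0+2) \<subseteq> {0}" by (rule Y_image[OF cyc]) (simp add: first5_def off_def)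
    show "?c ` Y v (0+3) \<subseteq> {2}" by (rule Y_image[OF cyc]) (simp add: first5_def off_def)
    show "?c ` Y v (0+4) \<subseteq> {3}" by (rule Y_image[OF cyc]) (simp add: first5_def off_def)
  qed (use an in \<open>simp_all add: stable_A[OF cyc] stable_Y[OF cyc] stable_Un anti_Un\<close>)
  then show ?thesis by blast
qed

text \<open>Each \<open>Y v j\<close> is paired with \<open>A v (j+4)\<close>. All five colours may
  occur on type \<open>Y\<close>; the last condition then has content and rests on
  \<open>F v j\<close> being complete to \<open>Y v (j+2)\<close> and
  \<open>Y v (j+3)\<close>.\<close>

lemma good_full_no_bad:
  assumes W: "W v = {}" and up: "\<And>j. anti (A v j) (Y v (j+1))"
  shows "\<exists>c. good_colouring v c"
proof -
  have ix: "(4::5) + 1 = 0" "(1::5) + 1 = 2" "(2::5) + 1 = 3" "(3::5) + 1 = 4" "(0::5) + 1 = 1" by simp_all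
  have an: "anti (Y v 0) (A v 4)" "anti (Y v 1) (A v 0)" "anti (Y v 2) (A v 1)"
    "anti (Y v 3) (A v 2)" "anti (Y v 4) (A v 3)"
    using up[of 4] up[of 0] up[of 1] up[of 2] up[of 3] anti_sym unfolding ix by blast+
  define n where "n j = (if j = (0::5) then 0 else if j = 1 then 1 else if j = 2 then 2
    else if j = 3 then 3 else (4::nat))" for j
  have j5: "j = 0 \<or> j = 1 \<or> j = 2 \<or> j = 3 \<or> j = 4" for j :: 5 using five_cases[of j 0] by simp
  have n: "n 0 = 0" "n 1 = 1" "n 2 = 2" "n 3 = 3" "n 4 = 4" by (simp_all add: n_def)
  have inj: "j = k" if "n j = n k" for j k
    using j5[of j] j5[of k] that by (elim disjE) (simp_all add: n)
  let ?c = "first5 (Y v 0 \<union> A v 4) (Y v 1 \<union> A v 0) (Y v 2 \<union> A v 1) (Y v 3 \<union> A v 2)"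
  have cn: "?c x = n j" if "x \<in> Y v j" for x j
    using j5[of j] that Y_mem[OF cyc that] by (elim disjE) (simp_all add: first5_def n_def)
  have "good_colouring v ?c"
  proof (rule good_colouringI[OF cyc, where ?S4.0 = "Y v 4 \<union> A v 3" and K = "\<lambda>j. {n j}"])
    show "AA v \<union> YY v \<subseteq> Y v 0 \<union> A v 4 \<union> (Y v 1 \<union> A v 0) \<union> (Y v 2 \<union> A v 1) \<union> (Y v 3 \<union> A v 2) \<union> (Y v 4 \<union> A v 3)"
      by (rule AA_YY_subset[OF cyc, of 0]) auto
    show "card ({n j} \<union> {n (j+2)}) \<le> 2" for j by (cases "n j = n (j+2)") simp_all
    fix S z assume S: "S \<subseteq> YY v" and z: "z \<in> ZZ v" and c5: "5 \<le> card (?c ` S)"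
    have "?c ` S \<subseteq> {..<5}" by (auto simp: first5_def)
    then have img: "?c ` S = {..<5}" using c5 by (intro card_subset_eq) (auto dest: card_mono[rotated])
    \<comment> \<open>The classes \<open>Y\<close> have pairwise different colours, so a set showing
      all five colours meets each of them.\<close>
    have meet: "\<exists>y\<in>S. y \<in> Y v j" for j
    proof -
      have "n j \<in> ?c ` S" unfolding img by (simp add: n_def)
      then obtain y where y: "y \<in> S" "?c y = n j" by auto
      then obtain k where "y \<in> Y v k" using S unfolding YY_def by blast
      then show ?thesis using cn[of y k] y inj by metis
    qed
    obtain j where j: "z \<in> F v j" using z W unfolding ZZ_def by blast
    obtain x y where xy: "x \<in> S" "x \<in> Y v (j+2)" "y \<in> S" "y \<in> Y v (j+3)" using meet by blast
    have "j + 3 = j + 2 + 1" by simp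
    then have "adj x y" by (rule Y_Y_complete[OF cyc xy(2,4)])
    then show "\<exists>x\<in>S. \<exists>y\<in>S. adj x y \<and> adj z x \<and> adj z y"
      using F_Y_complete[OF cyc j xy(2)] F_Y_complete_mirror[OF j xy(4)] xy by blast
  qed (use an cn in \<open>auto simp: stable_A[OF cyc] stable_Y[OF cyc] stable_Un anti_Un\<close>)
  then show ?thesis by blast
qed

lemma good_full:
  assumes ne: "\<And>j. Y v j \<noteq> {}"
  shows "\<exists>c. good_colouring v c"
proof (cases "\<exists>i x b. x \<in> A v i \<and> b \<in> Y v (i+1) \<and> adj x b")
  case True
  then obtain i x b where "x \<in> A v i" "b \<in> Y v (i+1)" "adj x b" by blast
  moreover obtain a c d e where "a \<in> Y v i" "c \<in> Y v (i+2)" "d \<in> Y v (i+3)" "e \<in> Y v (i+4)"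
    using ne[of i] ne[of "i+2"] ne[of "i+3"] ne[of "i+4"] by blast
  ultimately show ?thesis using good_full_bad by blast
next
  case False
  then have "\<And>j. anti (A v j) (Y v (j+1))" unfolding anti_def by blast
  then show ?thesis using good_full_W[OF ne] good_full_no_bad by blast
qed

section \<open>No induced 5-cycle with two consecutive non-empty classes Y\<close>

lemma A_A_anticomplete_bad_mirror:
  assumes a: "a \<in> Y v i" and c: "c \<in> Y v k" and x3: "x3 \<in> A v k" and x4: "x4 \<in> A v l"
    and x5: "x5 \<in> A v m" and idx: "k = i + 3" "l = i + 2" "m = i + 1"
    and x4c: "adj x4 c" and x5a: "adj x5 a"
  shows "\<not> adj x3 x5"
proof -
  have ix: "- k = - i + 2" "- l = - i + 3" "- m = - i + 4"
    by (simp_all add: idx minus_five_eq)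
  note * = A_mirror[of v "- k"] A_mirror[of v "- l"] A_mirror[of v "- m"] Y_mirror[of v "- i"]
    Y_mirror[of v "- k"]
  show ?thesis
    by (rule A_A_anticomplete_bad[OF cyc_mirror[OF cyc] _ _ _ _ _ ix x4c x5a])
      (use a c x3 x4 x5 in \<open>simp_all only: * minus_minus\<close>)
qed

text \<open>Replacing \<open>v (i + 2)\<close> by \<open>x\<close> would turn \<open>z\<close> into a vertex of type \<open>Y\<close> at \<open>i + 4\<close>, next to \<open>y\<close>.\<close>

lemma no_consecutive_A_A:
  assumes nc: no_consecutive and y: "y \<in> Y v i" and x: "x \<in> A v k" and z: "z \<in> A v i"
    and k: "k = i + 2" and xy: "adj x y"
  shows "\<not> adj x z"
proof
  assume xz: "adj x z"
  let ?v = "v(k := x)"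
  have "cyc ?v" by (rule cyc_upd[OF cyc x])
  moreover have "y \<in> Y ?v i"
    using Y_adj[OF cyc y] xy adj_sym[of x y] by (simp add: Y_def k)
  moreover have "z \<in> Y ?v (i+4)"
    unfolding Y_def mem_Collect_eq all_five[of _ i] using A_adj[OF cyc z] xz adj_sym[of x z]
    by (simp add: k)
  moreover have "i + 4 + 1 = i" by simp
  ultimately show False using nc unfolding no_consecutive_def by (metis empty_iff)
qed

text \<open>\<open>A v (i+2)\<close> is split: vertices missing \<open>Y v i\<close> take its
  colour, the others are anticomplete to \<open>A v i\<close> by the exchange argument and go there.
  \<open>Y v (i+2)\<close> may be empty or not.\<close>

lemma good_single:
  assumes nc: no_consecutive and y: "y \<in> Y v i"
    and e: "Y v (i+1) = {}" "Y v (i+3) = {}" "Y v (i+4) = {}"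
    and an: "anti (A v (i+3)) (Y v (i+2))"
  shows "\<exists>c. good_colouring v c"
proof -
  let ?B = "A v (i+2) - off (A v (i+2)) (Y v i)"
  let ?S0 = "Y v i \<union> off (A v (i+4)) (Y v i) \<union> off (A v (i+2)) (Y v i)"
  let ?S1 = "Y v (i+2) \<union> A v (i+3)"
  let ?S3 = "A v i \<union> ?B"
  have an0: "anti (off (A v (i+4)) (Y v i)) (off (A v (i+2)) (Y v i))"
    by (subst anti_sym, rule anti_off_A_A[OF cyc y], simp)
  have an3: "anti (A v i) ?B"
    unfolding anti_def
  proof (intro ballI)
    fix z x assume z: "z \<in> A v i" and x: "x \<in> ?B"
    obtain y' where y': "y' \<in> Y v i" "adj x y'" "x \<in> A v (i+2)" using x unfolding off_def by blast
    then have "\<not> adj x z" using no_consecutive_A_A[OF nc y'(1,3) z refl y'(2)] by blast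
    then show "\<not> adj z x" using adj_sym[of x z] by simp
  qed
  have "good_colouring v (first5 ?S0 ?S1 (A v (i+1)) ?S3)"
  proof (rule good_colouringI'[OF cyc, where ?S4.0 = "A v (i+4)" and i = i and T = "{0,1}" and ?K0.0 = "{0}"
        and ?K1.0 = "{}" and ?K2.0 = "{1}" and ?K3.0 = "{}" and ?K4.0 = "{}"])
    show "stable_set ?S0" "stable_set ?S1" "stable_set ?S3"
      using an0 an an3 anti_sym[of "A v (i+3)" "Y v (i+2)"]
      by (simp_all add: stable_Un anti_Un stable_A[OF cyc] stable_Y[OF cyc] stable_off anti_off stable_Diff)
    show "AA v \<union> YY v \<subseteq> ?S0 \<union> ?S1 \<union> A v (i+1) \<union> ?S3 \<union> A v (i+4)"
      by (rule AA_YY_subset[OF cyc, of i]) (auto simp: e)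
    show "first5 ?S0 ?S1 (A v (i+1)) ?S3 ` Y v i \<subseteq> {0}"
      by (rule Y_image[OF cyc]) (simp add: first5_def off_def)
    show "first5 ?S0 ?S1 (A v (i+1)) ?S3 ` Y v (i+2) \<subseteq> {1}"
      by (rule Y_image[OF cyc]) (simp add: first5_def off_def)
  qed (simp_all add: stable_A[OF cyc] e)
  then show ?thesis by blast
qed

text \<open>Neither orientation of \<open>good_single\<close> applies. The bad vertices
  \<open>x\<close> and \<open>z\<close> now work for each other: by
  \<open>A_A_anticomplete_bad\<close> and its mirror, the bad parts of \<open>A v (i+4)\<close> and
  \<open>A v (i+3)\<close> can join \<open>A v (i+2)\<close> and \<open>A v i\<close>.\<close>

lemma good_pair_bad:
  assumes a: "a \<in> Y v i" and c: "c \<in> Y v (i+2)"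
    and e: "Y v (i+1) = {}" "Y v (i+3) = {}" "Y v (i+4) = {}"
    and x: "x \<in> A v (i+3)" "adj x c" and z: "z \<in> A v (i+4)" "adj z a"
  shows "\<exists>c. good_colouring v c"
proof -
  let ?B = "A v (i+4) - off (A v (i+4)) (Y v i)"
  let ?B' = "A v (i+3) - off (A v (i+3)) (Y v (i+2))"
  let ?S0 = "Y v i \<union> off (A v (i+4)) (Y v i) \<union> off (A v (i+2)) (Y v i)"
  let ?S1 = "Y v (i+2) \<union> off (A v (i+3)) (Y v (i+2)) \<union> off (A v i) (Y v (i+2))"
  let ?S3 = "A v (i+2) \<union> ?B"
  let ?S4 = "A v i \<union> ?B'"
  have ix: "i = i + 2 + 3" "i + 4 = i + 2 + 2" "i + 3 = i + 2 + 1" by simp_all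
  have an0: "anti (off (A v (i+4)) (Y v i)) (off (A v (i+2)) (Y v i))"
    by (subst anti_sym, rule anti_off_A_A[OF cyc a], simp)
  have an1: "anti (off (A v (i+3)) (Y v (i+2))) (off (A v i) (Y v (i+2)))"
    by (subst anti_sym, rule anti_off_A_A[OF cyc c], simp)
  have an3: "anti (A v (i+2)) ?B"
    unfolding anti_def
  proof (intro ballI)
    fix w w' assume w: "w \<in> A v (i+2)" and w': "w' \<in> ?B"
    obtain y where y: "y \<in> Y v i" "adj w' y" "w' \<in> A v (i+4)" using w' unfolding off_def by blast
    show "\<not> adj w w'"
      by (rule A_A_anticomplete_bad[OF cyc y(1) c w x(1) y(3) refl refl refl x(2) y(2)])
  qed
  have an4: "anti (A v i) ?B'"
    unfolding anti_def
  proof (intro ballI)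
    fix w w' assume w: "w \<in> A v i" and w': "w' \<in> ?B'"
    obtain y where y: "y \<in> Y v (i+2)" "adj w' y" "w' \<in> A v (i+3)" using w' unfolding off_def by blast
    show "\<not> adj w w'"
      by (rule A_A_anticomplete_bad_mirror[OF y(1) a w z(1) y(3) ix z(2) y(2)])
  qed
  have "good_colouring v (first5 ?S0 ?S1 (A v (i+1)) ?S3)"
  proof (rule good_colouringI'[OF cyc, where ?S4.0 = ?S4 and i = i and T = "{0,1}" and ?K0.0 = "{0}"
        and ?K1.0 = "{}" and ?K2.0 = "{1}" and ?K3.0 = "{}" and ?K4.0 = "{}"])
    show "stable_set ?S0" "stable_set ?S1" "stable_set ?S3" "stable_set ?S4"
      using an0 an1 an3 an4
      by (simp_all add: stable_Un anti_Un stable_A[OF cyc] stable_Y[OF cyc] stable_off anti_off stable_Diff)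
    show "AA v \<union> YY v \<subseteq> ?S0 \<union> ?S1 \<union> A v (i+1) \<union> ?S3 \<union> ?S4"
      by (rule AA_YY_subset[OF cyc, of i]) (auto simp: e)
    show "first5 ?S0 ?S1 (A v (i+1)) ?S3 ` Y v i \<subseteq> {0}"
      by (rule Y_image[OF cyc]) (simp add: first5_def off_def)
    show "first5 ?S0 ?S1 (A v (i+1)) ?S3 ` Y v (i+2) \<subseteq> {1}"
      by (rule Y_image[OF cyc]) (simp add: first5_def off_def)
  qed (simp_all add: stable_A[OF cyc] e)
  then show ?thesis by blast
qed

end

section \<open>Case distinction over the non-empty classes Y\<close>

context
  fixes v :: "5 \<Rightarrow> 'a"
  assumes cyc: "cyc v"
begin

lemma good_single_mirror:
  assumes nc: no_consecutive and y: "y \<in> Y v i"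
    and e: "Y v j = {}" "Y v k = {}" "Y v l = {}"
    and an: "anti (A v k) (Y v m)" and idx: "j = i + 4" "k = i + 2" "l = i + 1" "m = i + 3"
  shows "\<exists>c. good_colouring v c"
proof -
  have "\<exists>c. good_colouring (\<lambda>j. v (- j)) c"
  proof (rule good_single[OF cyc_mirror[OF cyc] nc, of y "- i"])
    have ix: "- (- i + 1) = j" "- (- i + 2) = m" "- (- i + 3) = k" "- (- i + 4) = l"
      by (simp_all add: idx minus_five_eq)
    show "y \<in> Y (\<lambda>j. v (- j)) (- i)" "Y (\<lambda>j. v (- j)) (- i + 1) = {}"
      "Y (\<lambda>j. v (- j)) (- i + 3) = {}" "Y (\<lambda>j. v (- j)) (- i + 4) = {}"
      "anti (A (\<lambda>j. v (- j)) (- i + 3)) (Y (\<lambda>j. v (- j)) (- i + 2))"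
      unfolding Y_mirror A_mirror ix using y e an by simp_all
  qed
  then show ?thesis by (simp add: good_colouring_mirror)
qed

text \<open>Only \<open>Y v i\<close> and \<open>Y v (i+2)\<close> can be non-empty. The reflection
  exchanging them turns one one-sided hypothesis into the other; if both fail, there are bad
  vertices on both sides.\<close>

lemma good_no_consecutive:
  assumes nc: no_consecutive and a: "a \<in> Y v i" and e3: "Y v (i+3) = {}"
  shows "\<exists>c. good_colouring v c"
proof -
  have e1: "Y v (i+1) = {}" using nc cyc a unfolding no_consecutive_def by blast
  have ix: "i + 4 + 1 = i" by simp
  have "Y v (i+4) = {} \<or> Y v (i+4+1) = {}" using nc cyc unfolding no_consecutive_def by blast
  then have e4: "Y v (i+4) = {}" using a unfolding ix by blast
  show ?thesis
  proof (cases "anti (A v (i+3)) (Y v (i+2))")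
    case True
    then show ?thesis by (rule good_single[OF cyc nc a e1 e3 e4])
  next
    case False
    then obtain x c where x: "x \<in> A v (i+3)" "adj x c" and c: "c \<in> Y v (i+2)"
      unfolding anti_def by blast
    show ?thesis
    proof (cases "anti (A v (i+4)) (Y v i)")
      case True
      have "i + 1 = i + 2 + 4" "i + 4 = i + 2 + 2" "i + 3 = i + 2 + 1" "i = i + 2 + 3" by simp_all
      then show ?thesis by (rule good_single_mirror[OF nc c e1 e4 e3 True])
    next
      case False
      then obtain z b where "z \<in> A v (i+4)" "adj z b" "b \<in> Y v i"
        unfolding anti_def by blast
      then show ?thesis using good_pair_bad[OF cyc _ c e1 e3 e4 x] by blast
    qed
  qed
qed

text \<open>The run of non-empty classes starts at \<open>i\<close>. The two-class colouring is
  tried from its first end, then mirrored from its last end. For a run of three, badness at one end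
  excludes it at the other; for a run of four, badness at both ends is the hypothesis of
  \<open>good_four\<close>.\<close>

lemma good_run:
  assumes a: "a \<in> Y v i" and b: "b \<in> Y v (i+1)" and e: "Y v (i+4) = {}"
  shows "\<exists>c. good_colouring v c"
proof (cases "anti (A v (i+3)) (Y v (i+2))")
  case True
  then show ?thesis by (rule good_two_consecutive[OF cyc a b e])
next
  case False
  then obtain x c where x: "x \<in> A v (i+3)" "adj x c" and c: "c \<in> Y v (i+2)"
    unfolding anti_def by blast
  show ?thesis
  proof (cases "Y v (i+3) = {}")
    case e3: True
    have "anti (A v (i+4)) (Y v i)"
      unfolding anti_def using bad_A_A_three[OF cyc x(1) _ _ b c refl refl refl refl] x(2) by blast
    moreover have "i + 1 = i + 2 + 4" "i = i + 2 + 3" "i + 4 = i + 2 + 2" "i + 3 = i + 2 + 1" by simp_all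
    ultimately show ?thesis by (rule good_two_consecutive_mirror[OF cyc c b e3])
  next
    case False
    then obtain d where d: "d \<in> Y v (i+3)" by blast
    show ?thesis
    proof (cases "anti (A v i) (Y v (i+1))")
      case True
      have "i + 2 = i + 3 + 4" "i + 1 = i + 3 + 3" "i = i + 3 + 2" "i + 4 = i + 3 + 1" by simp_all
      then show ?thesis by (rule good_two_consecutive_mirror[OF cyc d c e True])
    next
      case False
      then obtain z b' where "z \<in> A v i" "adj z b'" "b' \<in> Y v (i+1)"
        unfolding anti_def by blast
      then show ?thesis using good_four[OF cyc a _ c d e _ _ x] by blast
    qed
  qed
qed

lemma good_consecutive:
  assumes a: "a \<in> Y v i" and b: "b \<in> Y v (i+1)"
  shows "\<exists>c. good_colouring v c"
proof -
  have ix: "i + 4 + 1 = i" "i + 3 + 1 = i + 4" "i + 4 + 4 = i + 3" "i + 3 + 4 = i + 2" by simp_all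
  show ?thesis
  proof (cases "Y v (i+4) = {}")
    case True
    then show ?thesis by (rule good_run[OF a b])
  next
    case False
    then obtain e where e: "e \<in> Y v (i+4)" by blast
    show ?thesis
    proof (cases "Y v (i+3) = {}")
      case True
      then show ?thesis using good_run[OF e] a unfolding ix by blast
    next
      case False
      then obtain d where d: "d \<in> Y v (i+3)" by blast
      show ?thesis
      proof (cases "Y v (i+2) = {}")
        case True
        then show ?thesis using good_run[OF d] e unfolding ix by blast
      next
        case False
        have "Y v j \<noteq> {}" for j using five_cases[of j i] a b False d e by blast
        then show ?thesis by (rule good_full[OF cyc])
      qed
    qed
  qed
qed

end

text \<open>The cycle is quantified anew in the conclusion, since the given one is abandoned when
  another cycle has consecutive non-empty classes.\<close>

theorem exists_good_colouring:
  assumes cyc: "cyc v" and ne: "YY v \<noteq> {}"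
  shows "\<exists>v c. cyc v \<and> YY v \<noteq> {} \<and> good_colouring v c"
proof (cases no_consecutive)
  case False
  then obtain w i a b where w: "cyc w" "a \<in> Y w i" "b \<in> Y w (i+1)"
    unfolding no_consecutive_def by blast
  then show ?thesis using good_consecutive[OF w] unfolding YY_def by blast
next
  case nc: True
  obtain i a where a: "a \<in> Y v i" using ne unfolding YY_def by blast
  have "\<exists>c. good_colouring v c"
  proof (cases "Y v (i+3) = {}")
    case True
    then show ?thesis by (rule good_no_consecutive[OF cyc nc a])
  next
    case False
    have ix: "i + 2 + 1 = i + 3" by simp
    have "Y v (i+2) = {} \<or> Y v (i+2+1) = {}" using nc cyc unfolding no_consecutive_def by blast
    then have e2: "Y v (i+2) = {}" using False unfolding ix by blast
    have "- (- i + 3) = i + 2" by (simp add: minus_five_eq)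
    then have "\<exists>c. good_colouring (\<lambda>j. v (- j)) c"
      using good_no_consecutive[OF cyc_mirror[OF cyc] nc, of a "- i"] a e2
      unfolding Y_mirror by (simp only: minus_minus)
    then show ?thesis by (simp add: good_colouring_mirror)
  qed
  then show ?thesis using cyc ne by blast
qed

section \<open>Components without a neighbour on the cycle\<close>

lemma first_match_proper:
  fixes n :: nat
  assumes "\<And>k. k < n \<Longrightarrow> stable_set (S k)" and "Q \<subseteq> (\<Union>k<n. S k)"
  shows "\<exists>f. (\<forall>x\<in>Q. f x < n) \<and> (\<forall>x\<in>Q. \<forall>y\<in>Q. adj x y \<longrightarrow> f x \<noteq> f y)"
proof -
  define f where "f x = (LEAST k. k < n \<and> x \<in> S k)" for x
  have f: "f x < n \<and> x \<in> S (f x)" if "x \<in> Q" for x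
  proof -
    have "\<exists>k. k < n \<and> x \<in> S k" using that assms(2) by blast
    then show ?thesis unfolding f_def using LeastI_ex[of "\<lambda>k. k < n \<and> x \<in> S k"] by blast
  qed
  then have "\<forall>x\<in>Q. \<forall>y\<in>Q. adj x y \<longrightarrow> f x \<noteq> f y"
    using assms(1) unfolding stable_set_def by metis
  then show ?thesis using f by blast
qed

context
  fixes v :: "5 \<Rightarrow> 'a"
  assumes cyc: "cyc v"
begin

text \<open>The facts \<open>P\<close> exclude one neighbour or two consecutive ones on the cycle,
  the facts \<open>T\<close> three consecutive ones; the rest is propositional.\<close>

lemma V_cases: "V \<subseteq> AA v \<union> YY v \<union> ZZ v \<union> D v"
proof
  fix x assume x: "x \<in> V"
  note five = all_five[of _ 0] add_0
  have P: "\<not> (adj x (v i) \<and> \<not> adj x (v (i+1)) \<and> \<not> adj x (v (i+2)) \<and> \<not> adj x (v (i+3)))" for i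
    using no_P5[of x "v i" "v (i+1)" "v (i+2)" "v (i+3)"] by (simp add: v_adj[OF cyc])
  have T: "\<not> (adj x (v (i+4)) \<and> adj x (v i) \<and> adj x (v (i+1)) \<and> \<not> adj x (v (i+2)) \<and> \<not> adj x (v (i+3)))" for i
    using no_T[of "v i" "v (i+1)" "v (i+2)" "v (i+3)" "v (i+4)" x] by (simp add: v_adj[OF cyc])
  have ix: "(1::5) + 1 = 2" "(1::5) + 2 = 3" "(1::5) + 3 = 4" "(1::5) + 4 = 0"
    "(2::5) + 1 = 3" "(2::5) + 2 = 4" "(2::5) + 3 = 0" "(2::5) + 4 = 1"
    "(3::5) + 1 = 4" "(3::5) + 2 = 0" "(3::5) + 3 = 1" "(3::5) + 4 = 2"
    "(4::5) + 1 = 0" "(4::5) + 2 = 1" "(4::5) + 3 = 2" "(4::5) + 4 = 3" by simp_all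
  note P' = P[of 0, unfolded add_0] P[of 1, unfolded ix] P[of 2, unfolded ix] P[of 3, unfolded ix] P[of 4, unfolded ix]
  note T' = T[of 0, unfolded add_0] T[of 1, unfolded ix] T[of 2, unfolded ix] T[of 3, unfolded ix] T[of 4, unfolded ix]
  let ?p = "\<lambda>j. adj x (v j)"
  have A: "x \<in> A v 0 \<longleftrightarrow> \<not> ?p 0 \<and> ?p 1 \<and> \<not> ?p 2 \<and> \<not> ?p 3 \<and> ?p 4"
    "x \<in> A v 1 \<longleftrightarrow> ?p 0 \<and> \<not> ?p 1 \<and> ?p 2 \<and> \<not> ?p 3 \<and> \<not> ?p 4"
    "x \<in> A v 2 \<longleftrightarrow> \<not> ?p 0 \<and> ?p 1 \<and> \<not> ?p 2 \<and> ?p 3 \<and> \<not> ?p 4"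
    "x \<in> A v 3 \<longleftrightarrow> \<not> ?p 0 \<and> \<not> ?p 1 \<and> ?p 2 \<and> \<not> ?p 3 \<and> ?p 4"
    "x \<in> A v 4 \<longleftrightarrow> ?p 0 \<and> \<not> ?p 1 \<and> \<not> ?p 2 \<and> ?p 3 \<and> \<not> ?p 4"
    by (simp_all add: A_def five)
  have Y: "x \<in> Y v 0 \<longleftrightarrow> ?p 0 \<and> \<not> ?p 1 \<and> ?p 2 \<and> ?p 3 \<and> \<not> ?p 4"
    "x \<in> Y v 1 \<longleftrightarrow> \<not> ?p 0 \<and> ?p 1 \<and> \<not> ?p 2 \<and> ?p 3 \<and> ?p 4"
    "x \<in> Y v 2 \<longleftrightarrow> ?p 0 \<and> \<not> ?p 1 \<and> ?p 2 \<and> \<not> ?p 3 \<and> ?p 4"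
    "x \<in> Y v 3 \<longleftrightarrow> ?p 0 \<and> ?p 1 \<and> \<not> ?p 2 \<and> ?p 3 \<and> \<not> ?p 4"
    "x \<in> Y v 4 \<longleftrightarrow> \<not> ?p 0 \<and> ?p 1 \<and> ?p 2 \<and> \<not> ?p 3 \<and> ?p 4"
    by (simp_all add: Y_def five)
  have F: "x \<in> F v 0 \<longleftrightarrow> \<not> ?p 0 \<and> ?p 1 \<and> ?p 2 \<and> ?p 3 \<and> ?p 4"
    "x \<in> F v 1 \<longleftrightarrow> ?p 0 \<and> \<not> ?p 1 \<and> ?p 2 \<and> ?p 3 \<and> ?p 4"
    "x \<in> F v 2 \<longleftrightarrow> ?p 0 \<and> ?p 1 \<and> \<not> ?p 2 \<and> ?p 3 \<and> ?p 4"
    "x \<in> F v 3 \<longleftrightarrow> ?p 0 \<and> ?p 1 \<and> ?p 2 \<and> \<not> ?p 3 \<and> ?p 4"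
    "x \<in> F v 4 \<longleftrightarrow> ?p 0 \<and> ?p 1 \<and> ?p 2 \<and> ?p 3 \<and> \<not> ?p 4"
    by (simp_all add: F_def five)
  have W: "x \<in> W v \<longleftrightarrow> ?p 0 \<and> ?p 1 \<and> ?p 2 \<and> ?p 3 \<and> ?p 4"
    by (simp add: W_def five)
  have D: "x \<in> D v \<longleftrightarrow> \<not> ?p 0 \<and> \<not> ?p 1 \<and> \<not> ?p 2 \<and> \<not> ?p 3 \<and> \<not> ?p 4"
    using x by (simp add: D_def five)
  have "x \<in> A v 0 \<or> x \<in> A v 1 \<or> x \<in> A v 2 \<or> x \<in> A v 3 \<or> x \<in> A v 4 \<or>
    x \<in> Y v 0 \<or> x \<in> Y v 1 \<or> x \<in> Y v 2 \<or> x \<in> Y v 3 \<or> x \<in> Y v 4 \<or>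
    x \<in> F v 0 \<or> x \<in> F v 1 \<or> x \<in> F v 2 \<or> x \<in> F v 3 \<or> x \<in> F v 4 \<or> x \<in> W v \<or> x \<in> D v"
    unfolding A Y F W D using P' T' by argo
  then show "x \<in> AA v \<union> YY v \<union> ZZ v \<union> D v"
    unfolding AA_def YY_def ZZ_def by blast
qed

lemma stable_ZZ: "stable_set (ZZ v)"
  unfolding stable_set_def ZZ_def
proof (intro ballI)
  fix x y assume "x \<in> W v \<union> (\<Union>i. F v i)" "y \<in> W v \<union> (\<Union>i. F v i)"
  then consider "x \<in> W v" "y \<in> W v" | i where "x \<in> F v i" "y \<in> W v" | i where "x \<in> W v" "y \<in> F v i"
    | i j where "x \<in> F v i" "y \<in> F v j" by blast
  then show "\<not> adj x y"
  proof cases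
    case 1 then show ?thesis by (rule W_stable[OF cyc])
  next
    case 2 then show ?thesis by (rule F_W_anticomplete[OF cyc])
  next
    case 3 then show ?thesis using F_W_anticomplete[OF cyc 3(2,1)] adj_sym[of x y] by simp
  next
    case 4 then show ?thesis by (rule F_F_anticomplete[OF cyc])
  qed
qed

lemma AA_D_anticomplete: "x \<in> AA v \<Longrightarrow> d \<in> D v \<Longrightarrow> \<not> adj x d"
  unfolding AA_def using A_D_anticomplete[OF cyc] by blast

lemma D_homogeneous_Y:
  assumes d: "d \<in> D v" and e: "e \<in> D v" and de: "adj d e" and y: "y \<in> Y v i" and dy: "adj d y"
  shows "adj e y"
  using no_P5[of "v (i+4)" "v i" y d e] D_adj[OF cyc d] D_adj[OF cyc e] Y_adj[OF cyc y] de dy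
  by (simp add: v_adj[OF cyc] adj_sym)

lemma D_homogeneous_F:
  assumes d: "d \<in> D v" and e: "e \<in> D v" and de: "adj d e" and f: "f \<in> F v i" and df: "adj d f"
  shows "adj e f"
  using no_P5[of "v i" "v (i+1)" f d e] D_adj[OF cyc d] D_adj[OF cyc e] F_adj[OF cyc f] de df
  by (simp add: v_adj[OF cyc] adj_sym)

text \<open>\<open>w\<close> sees the whole cycle, so no \<open>P5\<close> can leave it along the
  cycle alone. It ends in \<open>y\<close>, which \<open>w\<close> misses; hence the requirement
  that \<open>d\<close> and \<open>e\<close> miss \<open>y\<close> too.\<close>

lemma D_homogeneous_W:
  assumes d: "d \<in> D v" and e: "e \<in> D v" and de: "adj d e" and w: "w \<in> W v" and dw: "adj d w"
    and y: "y \<in> Y v i" and n: "\<not> adj d y" "\<not> adj e y"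
  shows "adj e w"
  using no_P5[of e d w "v (i+2)" y] D_adj[OF cyc d] D_adj[OF cyc e] W_adj[OF cyc w] Y_adj[OF cyc y]
    Y_W_anticomplete[OF cyc y w] de dw n
  by (simp add: adj_sym)

text \<open>Otherwise \<open>x\<close>, \<open>y\<close>, \<open>d\<close>, \<open>e\<close> are a
  \<open>K4\<close>. Vertices from two different classes \<open>Y\<close> always share a cycle
  neighbour, which completes an HVN.\<close>

lemma D_edge_Y_Y:
  assumes d: "d \<in> D v" and e: "e \<in> D v" and de: "adj d e"
    and x: "x \<in> YY v" and y: "y \<in> YY v" and xy: "adj d x" "adj e x" "adj d y" "adj e y"
  shows "\<not> adj x y"
proof
  assume a: "adj x y"
  have one: False if x: "x \<in> Y v i" and y: "y \<in> Y v j" and j: "j = i + 1"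
    and xy: "adj d x" "adj e x" "adj d y" "adj e y" "adj x y" for x y i j
    using no_HVN[of x y d e "v (i+3)"] D_adj[OF cyc d] D_adj[OF cyc e] Y_adj[OF cyc x] Y_adj[OF cyc y] de xy
    by (simp add: adj_sym j)
  have two: False if x: "x \<in> Y v i" and y: "y \<in> Y v j" and j: "j = i + 2"
    and xy: "adj d x" "adj e x" "adj d y" "adj e y" "adj x y" for x y i j
    using no_HVN[of x y d e "v i"] D_adj[OF cyc d] D_adj[OF cyc e] Y_adj[OF cyc x] Y_adj[OF cyc y] de xy
    by (simp add: adj_sym j)
  obtain i j where ij: "x \<in> Y v i" "y \<in> Y v j" using x y unfolding YY_def by blast
  have a': "adj y x" using a adj_sym[of x y] by simp
  consider "j = i" | "j = i + 1" | "i = j + 1" | "j = i + 2" | "i = j + 2"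
    using five_cases[of j i] by force
  then show False
  proof cases
    case 1 then show False using Y_stable[OF cyc ij(1)] ij(2) a by blast
  next
    case 2 then show False using one[OF ij 2] xy a by blast
  next
    case 3 then show False using one[OF ij(2,1) 3] xy a' by blast
  next
    case 4 then show False using two[OF ij 4] xy a by blast
  next
    case 5 then show False using two[OF ij(2,1) 5] xy a' by blast
  qed
qed

end

section \<open>Colouring connected sets that are triangle-free or lie in a neighbourhood\<close>

definition connected_set :: "'a set \<Rightarrow> bool" where
  "connected_set Q \<longleftrightarrow> (\<forall>S \<subseteq> Q. S \<noteq> {} \<longrightarrow> (\<forall>x\<in>S. \<forall>y\<in>Q. adj x y \<longrightarrow> y \<in> S) \<longrightarrow> S = Q)"

lemma connected_setD:
  "connected_set Q \<Longrightarrow> S \<subseteq> Q \<Longrightarrow> S \<noteq> {} \<Longrightarrow> (\<And>x y. x \<in> S \<Longrightarrow> y \<in> Q \<Longrightarrow> adj x y \<Longrightarrow> y \<in> S) \<Longrightarrow> S = Q"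
  unfolding connected_set_def by blast

text \<open>A vertex of type \<open>Y\<close>, \<open>F\<close> or \<open>W\<close> over
  \<open>u\<close> sees two consecutive cycle vertices, and type \<open>D\<close> cannot be reached
  from type \<open>A\<close>. So \<open>Q\<close> consists of type \<open>A\<close> only, and
  classes at distance two are anticomplete because they share a cycle neighbour.\<close>

lemma triangle_free_C5_colourable:
  assumes con: "connected_set Q" and QV: "Q \<subseteq> V"
    and tri: "\<And>a b c. a \<in> Q \<Longrightarrow> b \<in> Q \<Longrightarrow> c \<in> Q \<Longrightarrow> adj a b \<Longrightarrow> adj b c \<Longrightarrow> \<not> adj a c"
    and u: "cyc u" "range u \<subseteq> Q"
  shows "\<exists>f. (\<forall>x\<in>Q. f x < (3::nat)) \<and> (\<forall>x\<in>Q. \<forall>y\<in>Q. adj x y \<longrightarrow> f x \<noteq> f y)"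
proof -
  have uQ: "u j \<in> Q" for j using u(2) by blast
  have e: "adj (u j) (u (j+1))" for j by (simp add: v_adj[OF u(1)])
  have no: False if "y \<in> Q" "adj y (u j)" "adj y (u k)" "k = j + 1" for y j k
    using tri[OF that(1) uQ uQ that(2), of k] e[of j] that by simp
  have "Q \<inter> AA u = Q"
  proof (rule connected_setD[OF con])
    show "Q \<inter> AA u \<noteq> {}" using uQ v_in_A[OF u(1)] unfolding AA_def by blast
    fix x y assume xy: "x \<in> Q \<inter> AA u" "y \<in> Q" "adj x y"
    have "y \<notin> YY u"
    proof
      assume "y \<in> YY u"
      then obtain i where "y \<in> Y u i" unfolding YY_def by blast
      then show False using no[OF xy(2), of "i+2" "i+3"] Y_adj[OF u(1)] by simp
    qed
    moreover have "y \<notin> ZZ u"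
    proof
      assume "y \<in> ZZ u"
      then obtain i where "\<forall>j. j \<noteq> i \<longrightarrow> adj y (u j)" unfolding ZZ_def W_def F_def by blast
      then show False using no[OF xy(2), of "i+2" "i+3"] by simp
    qed
    moreover have "y \<notin> D u" using AA_D_anticomplete[OF u(1)] xy by blast
    ultimately show "y \<in> Q \<inter> AA u" using V_cases[OF u(1)] xy(2) QV by blast
  qed simp
  then have QA: "Q \<subseteq> AA u" by blast
  have two: "stable_set (Q \<inter> (A u i \<union> A u (i+2)))" for i
    unfolding stable_set_def
  proof (intro ballI notI)
    have far: False if "x \<in> Q" "y \<in> Q" "x \<in> A u i" "y \<in> A u (i+2)" "adj x y" for x y
    proof -
      have "adj x (u (i+1))" "adj (u (i+1)) y"
        using A_adj[OF u(1) that(3)] A_adj[OF u(1) that(4)] by simp_all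
      then show False using tri[OF that(1) uQ that(2)] that(5) by blast
    qed
    fix x y assume "x \<in> Q \<inter> (A u i \<union> A u (i+2))" "y \<in> Q \<inter> (A u i \<union> A u (i+2))" "adj x y"
    then show False using far[of x y] far[of y x] A_stable[OF u(1)] adj_sym[of x y] by blast
  qed
  \<comment> \<open>In type \<open>5\<close>, \<open>4 + 2\<close> is 1, so the third set contains
    \<open>A u 1\<close> a second time; the overlap is harmless and keeps all three sets in the form
    of \<open>two\<close>.\<close>
  define S where "S k = (if k = 0 then Q \<inter> (A u 0 \<union> A u (0+2)) else if k = 1 then Q \<inter> (A u 1 \<union> A u (1+2))
    else Q \<inter> (A u 4 \<union> A u (4+2)))" for k :: nat
  show ?thesis
  proof (rule first_match_proper[of 3 S])
    show "stable_set (S k)" for k using two[of 0] two[of 1] two[of 4] unfolding S_def by presburger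
    have "x \<in> S 0 \<union> S 1 \<union> S 2" if x: "x \<in> Q" for x
    proof -
      obtain i where i: "x \<in> A u i" using x QA unfolding AA_def by blast
      have S: "S 0 = Q \<inter> (A u 0 \<union> A u 2)" "S 1 = Q \<inter> (A u 1 \<union> A u 3)" "A u 4 \<inter> Q \<subseteq> S 2"
        unfolding S_def by auto
      show ?thesis using five_cases[of i 0] i x S unfolding add_0 by blast
    qed
    moreover have "(0::nat) < 3" "(1::nat) < 3" "(2::nat) < 3" by simp_all
    ultimately show "Q \<subseteq> (\<Union>k<3. S k)" by blast
  qed
qed

definition cyc_of :: "'a \<Rightarrow> 'a \<Rightarrow> 'a \<Rightarrow> 'a \<Rightarrow> 'a \<Rightarrow> 5 \<Rightarrow> 'a" where
  "cyc_of a b c d e j = (if j = 0 then a else if j = 1 then b else if j = 2 then c else if j = 3 then d else e)"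

lemma cyc_of_simps:
  "cyc_of a b c d e 0 = a" "cyc_of a b c d e 1 = b" "cyc_of a b c d e 2 = c"
  "cyc_of a b c d e 3 = d" "cyc_of a b c d e 4 = e"
  by (simp_all add: cyc_of_def)

lemma cyc_cyc_of:
  assumes "adj a b" "adj b c" "adj c d" "adj d e" "adj e a"
    "\<not> adj a c" "\<not> adj a d" "\<not> adj b d" "\<not> adj b e" "\<not> adj c e"
  shows "cyc (cyc_of a b c d e)"
  unfolding cyc_def all_five[of _ 0] add_0 cyc_of_simps
  using assms adj_irrefl adj_sym[of a b] adj_sym[of b c] adj_sym[of c d] adj_sym[of d e] adj_sym[of e a]
    adj_sym[of a c] adj_sym[of a d] adj_sym[of b d] adj_sym[of b e] adj_sym[of c e]
  by simp

lemma range_cyc_of: "range (cyc_of a b c d e) \<subseteq> {a,b,c,d,e}"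
  by (auto simp: cyc_of_def)

text \<open>Without an induced 5-cycle \<open>Q\<close> is bipartite: breadth-first layers from a
  root \<open>r\<close>, with even layers in one colour and odd ones in the other.\<close>

lemma triangle_free_colourable:
  assumes con: "connected_set Q" and QV: "Q \<subseteq> V"
    and tri: "\<And>a b c. a \<in> Q \<Longrightarrow> b \<in> Q \<Longrightarrow> c \<in> Q \<Longrightarrow> adj a b \<Longrightarrow> adj b c \<Longrightarrow> \<not> adj a c"
  shows "\<exists>f. (\<forall>x\<in>Q. f x < (3::nat)) \<and> (\<forall>x\<in>Q. \<forall>y\<in>Q. adj x y \<longrightarrow> f x \<noteq> f y)"
proof (cases "\<exists>u. cyc u \<and> range u \<subseteq> Q")
  case True
  then obtain u where u: "cyc u" "range u \<subseteq> Q" by blast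
  show ?thesis by (rule triangle_free_C5_colourable[OF con QV _ u]) (rule tri)
next
  case noC5: False
  show ?thesis
  proof (cases "Q = {}")
    case False
    then obtain r where r: "r \<in> Q" by blast
    define N1 where "N1 = {x\<in>Q. adj r x}"
    define N2 where "N2 = {x\<in>Q. x \<noteq> r \<and> \<not> adj r x \<and> (\<exists>p\<in>N1. adj p x)}"
    define N3 where "N3 = {x\<in>Q. x \<noteq> r \<and> \<not> adj r x \<and> \<not> (\<exists>p\<in>N1. adj p x) \<and> (\<exists>p\<in>N2. adj p x)}"
    \<comment> \<open>The path \<open>r\<close>, \<open>p1\<close>, \<open>p2\<close>,
      \<open>x\<close>, \<open>y\<close> would be an induced \<open>P5\<close>. This excludes at
      once a fourth layer and an edge inside the third.\<close>
    have r4: False if x: "x \<in> N3" and y: "y \<in> Q" "adj x y" "y \<noteq> r" "\<not> adj r y" "\<not> (\<exists>p\<in>N1. adj p y)" for x y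
    proof -
      obtain p2 where p2: "p2 \<in> N2" "adj p2 x" using x unfolding N3_def by blast
      obtain p1 where p1: "p1 \<in> N1" "adj p1 p2" using p2 unfolding N2_def by blast
      have Q: "p2 \<in> Q" "x \<in> Q" using p2 x unfolding N2_def N3_def by blast+
      have n: "\<not> adj p2 y" using tri[OF Q y(1) p2(2) y(2)] .
      have "adj r p1" "\<not> adj r p2" "\<not> adj r x" "\<not> adj p1 x"
        using p1 p2 x unfolding N1_def N2_def N3_def by blast+
      then show False using no_P5[of r p1 p2 x y] p1 p2 n y by blast
    qed
    have "{r} \<union> N1 \<union> N2 \<union> N3 = Q"
    proof (rule connected_setD[OF con])
      show "{r} \<union> N1 \<union> N2 \<union> N3 \<subseteq> Q" using r unfolding N1_def N2_def N3_def by blast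
      fix x y assume xy: "x \<in> {r} \<union> N1 \<union> N2 \<union> N3" "y \<in> Q" "adj x y"
      show "y \<in> {r} \<union> N1 \<union> N2 \<union> N3"
      proof (rule ccontr)
        assume "y \<notin> {r} \<union> N1 \<union> N2 \<union> N3"
        then have y: "y \<noteq> r" "\<not> adj r y" "\<not> (\<exists>p\<in>N1. adj p y)" "\<not> (\<exists>p\<in>N2. adj p y)"
          using xy(2) unfolding N1_def N2_def N3_def by blast+
        then have "x \<in> N3" using xy by blast
        then show False using r4 xy y by blast
      qed
    qed simp
    moreover have "stable_set ({r} \<union> N2)"
    proof -
      have "\<not> adj x y" if x: "x \<in> N2" and y: "y \<in> N2" for x y
      proof
        assume xy: "adj x y"
        obtain p q where p: "p \<in> N1" "adj p x" and q: "q \<in> N1" "adj q y"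
          using x y unfolding N2_def by blast
        have Q: "p \<in> Q" "q \<in> Q" "x \<in> Q" "y \<in> Q" "adj r p" "adj r q" "\<not> adj r x" "\<not> adj r y"
          using p q x y unfolding N1_def N2_def by blast+
        have n: "\<not> adj p y" using tri[OF Q(1,3,4) p(2) xy] .
        have n': "\<not> adj x q"
          using tri[OF Q(2,4,3) q(2)] xy adj_sym[of x y] adj_sym[of x q] by simp
        have n'': "\<not> adj p q" using tri[OF Q(1) r Q(2)] Q adj_sym[of p r] by simp
        have "cyc (cyc_of r p x y q)"
          using Q p q n n' n'' xy adj_sym[of q y] adj_sym[of q r] by (intro cyc_cyc_of) simp_all
        moreover have "range (cyc_of r p x y q) \<subseteq> Q" by (rule order_trans[OF range_cyc_of]) (use Q(1-4) r in simp)
        ultimately show False using noC5 by blast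
      qed
      moreover have "\<not> adj r x" "\<not> adj x r" if "x \<in> N2" for x
        using that adj_sym[of x r] unfolding N2_def by simp_all
      ultimately show ?thesis using adj_irrefl unfolding stable_set_def by blast
    qed
    moreover have "stable_set (N1 \<union> N3)"
    proof -
      have "\<not> adj x y" if x: "x \<in> N1" and y: "y \<in> N1" for x y
        using tri[OF _ r, of x y] that adj_sym[of x r] unfolding N1_def by simp
      moreover have "\<not> adj x y" "\<not> adj y x" if "x \<in> N1" "y \<in> N3" for x y
        using that adj_sym[of x y] unfolding N3_def by auto
      moreover have "\<not> adj x y" if "x \<in> N3" "y \<in> N3" for x y
        using r4[OF that(1), of y] that(2) unfolding N3_def by blast
      ultimately show ?thesis unfolding stable_set_def by blast
    qed
    ultimately have "\<exists>f. (\<forall>x\<in>Q. f x < (2::nat)) \<and> (\<forall>x\<in>Q. \<forall>y\<in>Q. adj x y \<longrightarrow> f x \<noteq> f y)"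
      by (intro first_match_proper[of 2 "\<lambda>k. if k = 0 then {r} \<union> N2 else N1 \<union> N3"]) 
        (auto simp: lessThan_Suc numeral_2_eq_2)
    then show ?thesis by (metis less_trans lessI numeral_3_eq_3 numeral_2_eq_2)
  qed simp
qed

definition clique :: "'a set \<Rightarrow> bool" where
  "clique K \<longleftrightarrow> K \<subseteq> V \<and> (\<forall>x\<in>K. \<forall>y\<in>K. x \<noteq> y \<longrightarrow> adj x y)"

lemma good_colouringD:
  assumes "good_colouring v c"
  shows "\<forall>x \<in> AA v \<union> YY v. c x < 5"
    and "\<forall>x \<in> AA v \<union> YY v. \<forall>y \<in> AA v \<union> YY v. adj x y \<longrightarrow> c x \<noteq> c y"
    and "\<forall>S \<subseteq> YY v. stable_set S \<longrightarrow> card (c ` S) \<le> 2"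
    and "\<forall>S \<subseteq> YY v. \<forall>z \<in> ZZ v. card (c ` S) \<ge> 5 \<longrightarrow>
      (\<exists>x\<in>S. \<exists>y\<in>S. adj x y \<and> adj z x \<and> adj z y)"
  using assms[unfolded good_colouring_def] by simp_all

lemma paw_free_colourable:
  assumes con: "connected_set Q" and QV: "Q \<subseteq> V" and z: "\<And>q. q \<in> Q \<Longrightarrow> adj z q"
    and abc: "a \<in> Q" "b \<in> Q" "c \<in> Q" "adj a b" "adj b c" "adj a c"
    and w: "\<And>K. clique K \<Longrightarrow> card K \<le> w"
  shows "\<exists>f. (\<forall>x\<in>Q. f x < w - 1) \<and> (\<forall>x\<in>Q. \<forall>y\<in>Q. adj x y \<longrightarrow> f x \<noteq> f y)"
proof -
  \<comment> \<open>A paw in the neighbourhood of \<open>z\<close> together with \<open>z\<close> is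
    an HVN.\<close>
  have paw: "adj x t2 \<or> adj x t3"
    if "t1 \<in> Q" "t2 \<in> Q" "t3 \<in> Q" "x \<in> Q" "adj t1 t2" "adj t1 t3" "adj t2 t3" "adj x t1" for t1 t2 t3 x
    using no_HVN[of z t1 t2 t3 x] z[OF that(1)] z[OF that(2)] z[OF that(3)] z[OF that(4)] that
      adj_sym[of x z] by blast
  \<comment> \<open>The property spreads along edges: \<open>x\<close> forms a triangle with two of
    the three vertices, so a neighbour of \<open>x\<close> sees one of them and, by
    \<open>paw\<close> again, a second one.\<close>
  have two: "(adj x a \<and> adj x b) \<or> (adj x b \<and> adj x c) \<or> (adj x a \<and> adj x c)"
    if t: "a \<in> Q" "b \<in> Q" "c \<in> Q" "adj a b" "adj b c" "adj a c" and x: "x \<in> Q" for a b c x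
  proof -
    note s = adj_sym[of a b] adj_sym[of b c] adj_sym[of a c]
    let ?S = "{x\<in>Q. (adj x a \<and> adj x b) \<or> (adj x b \<and> adj x c) \<or> (adj x a \<and> adj x c)}"
    have cl: "(adj y a \<and> adj y b) \<or> (adj y b \<and> adj y c) \<or> (adj y a \<and> adj y c)"
      if "y \<in> Q" "adj y a \<or> adj y b \<or> adj y c" for y
      using paw[of a b c y] paw[of b a c y] paw[of c a b y] t that s by blast
    have "?S = Q"
    proof (rule connected_setD[OF con])
      show "?S \<noteq> {}" using t s by blast
      fix x y assume x: "x \<in> ?S" and y: "y \<in> Q" "adj x y"
      have yx: "adj y x" using y adj_sym[of x y] by simp
      have "adj y a \<or> adj y b \<or> adj y c"
        using x paw[of x a b y, OF _ _ _ y(1) _ _ _ yx] paw[of x b c y, OF _ _ _ y(1) _ _ _ yx]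
          paw[of x a c y, OF _ _ _ y(1) _ _ _ yx] t by blast
      then show "y \<in> ?S" using cl[OF y(1)] y(1) by blast
    qed simp
    then show ?thesis using x by blast
  qed
  \<comment> \<open>Each end of the edge sees two of \<open>a\<close>, \<open>b\<close>,
    \<open>c\<close>, so both see a common one \<open>t\<close>; then \<open>u\<close> would have to
    see two vertices of the triangle \<open>x\<close>, \<open>y\<close>, \<open>t\<close>.
    Non-adjacency is thus an equivalence on \<open>Q\<close>, with \<open>cls\<close> as its
    classes.\<close>
  have trans: False if xyz: "x \<in> Q" "y \<in> Q" "u \<in> Q" "adj x y" "\<not> adj u x" "\<not> adj u y" for x y u
  proof -
    obtain t where t: "t \<in> Q" "adj x t" "adj y t"
      using two[OF abc xyz(1)] two[OF abc xyz(2)] abc(1-3) by blast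
    show False using two[OF xyz(1,2) t(1) xyz(4) t(3,2) xyz(3)] xyz by blast
  qed
  define cls where "cls x = {y\<in>Q. \<not> adj x y}" for x
  have cls_eq: "cls x = cls y" if xy: "x \<in> Q" "y \<in> Q" "\<not> adj x y" for x y
  proof -
    have "\<not> adj q u" if "p \<in> Q" "q \<in> Q" "\<not> adj p q" "u \<in> Q" "\<not> adj p u" for p q u
      using trans[of q u p] that by blast
    then show ?thesis unfolding cls_def using xy adj_sym[of x y] by blast
  qed
  have cls_neq: "cls x \<noteq> cls y" if "x \<in> Q" "y \<in> Q" "adj x y" for x y
    using that adj_irrefl[of y] unfolding cls_def by blast
  have finQ: "finite Q" using QV finite_V finite_subset by blast
  define r where "r = inv_into Q cls"
  have r: "r C \<in> Q" "cls (r C) = C" if "C \<in> cls ` Q" for C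
    unfolding r_def using that by (rule inv_into_into, rule f_inv_into_f)
  \<comment> \<open>One representative of each part, together with \<open>z\<close>, is a clique;
    this saves one colour against \<open>w\<close>.\<close>
  have "clique (insert z (r ` (cls ` Q)))"
    unfolding clique_def
  proof (intro conjI ballI impI)
    have "z \<in> V" using adj_V[OF z[OF abc(1)]] .
    then show "insert z (r ` cls ` Q) \<subseteq> V" using r(1) QV by blast
    fix x y assume "x \<in> insert z (r ` cls ` Q)" "y \<in> insert z (r ` cls ` Q)" and ne: "x \<noteq> y"
    then consider "x = z" "y \<in> Q" | "y = z" "x \<in> Q"
      | C C' where "x = r C" "y = r C'" "C \<in> cls ` Q" "C' \<in> cls ` Q" using r(1) by blast
    then show "adj x y"
    proof cases
      case 1 then show ?thesis using z by blast
    next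
      case 2 then show ?thesis using z adj_sym[of x y] by blast
    next
      case 3
      show ?thesis
      proof (rule ccontr)
        assume "\<not> adj x y"
        then have "cls x = cls y" using cls_eq r(1) 3 by blast
        then show False using r(2) 3 ne by metis
      qed
    qed
  qed
  then have "card (insert z (r ` (cls ` Q))) \<le> w" by (rule w)
  moreover have "z \<notin> r ` (cls ` Q)" using r(1) z adj_irrefl[of z] by blast
  moreover have "inj_on r (cls ` Q)" using r(2) by (metis inj_onI)
  ultimately have le: "card (cls ` Q) \<le> w - 1" using finQ by (simp add: card_image)
  obtain h where h: "bij_betw h (cls ` Q) {0..<card (cls ` Q)}"
    using ex_bij_betw_finite_nat[of "cls ` Q"] finQ by blast
  show ?thesis
  proof (intro exI[of _ "\<lambda>x. h (cls x)"] conjI ballI impI)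
    fix x assume x: "x \<in> Q"
    then have "h (cls x) \<in> {0..<card (cls ` Q)}" using h unfolding bij_betw_def by blast
    then show "h (cls x) < w - 1" using le by simp
    fix y assume y: "y \<in> Q" "adj x y"
    show "h (cls x) \<noteq> h (cls y)"
      using cls_neq[OF x y] h x y(1) unfolding bij_betw_def inj_on_def by blast
  qed
qed

lemma neighbourhood_colourable:
  assumes con: "connected_set Q" and QV: "Q \<subseteq> V" and z: "\<And>q. q \<in> Q \<Longrightarrow> adj z q"
    and w: "\<And>K. clique K \<Longrightarrow> card K \<le> w" and w3: "3 \<le> w"
  shows "\<exists>f. (\<forall>x\<in>Q. f x < w) \<and> (\<forall>x\<in>Q. \<forall>y\<in>Q. adj x y \<longrightarrow> f x \<noteq> f y)"
proof (cases "\<exists>a\<in>Q. \<exists>b\<in>Q. \<exists>c\<in>Q. adj a b \<and> adj b c \<and> adj a c")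
  case True
  then obtain a b c where abc: "a \<in> Q" "b \<in> Q" "c \<in> Q" "adj a b" "adj b c" "adj a c" by blast
  obtain f where "\<forall>x\<in>Q. f x < w - 1" "\<forall>x\<in>Q. \<forall>y\<in>Q. adj x y \<longrightarrow> f x \<noteq> f y"
    using paw_free_colourable[OF con QV z abc w] by blast
  then show ?thesis by (intro exI[of _ f]) force
next
  case False
  have "\<exists>f. (\<forall>x\<in>Q. f x < (3::nat)) \<and> (\<forall>x\<in>Q. \<forall>y\<in>Q. adj x y \<longrightarrow> f x \<noteq> f y)"
    by (rule triangle_free_colourable[OF con QV]) (use False in blast)
  then obtain f where "\<forall>x\<in>Q. f x < (3::nat)" "\<forall>x\<in>Q. \<forall>y\<in>Q. adj x y \<longrightarrow> f x \<noteq> f y" by blast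
  then show ?thesis using w3 by (intro exI[of _ f]) force
qed

section \<open>Components of D and the colouring of the whole graph\<close>

definition component :: "(5 \<Rightarrow> 'a) \<Rightarrow> 'a \<Rightarrow> 'a set" where
  "component v d = {x. (d, x) \<in> {(x, y). x \<in> D v \<and> y \<in> D v \<and> adj x y}\<^sup>*}"

lemma component_self: "d \<in> component v d"
  by (simp add: component_def)

lemma component_step: "x \<in> component v d \<Longrightarrow> x \<in> D v \<Longrightarrow> y \<in> D v \<Longrightarrow> adj x y \<Longrightarrow> y \<in> component v d"
  unfolding component_def mem_Collect_eq by (erule rtrancl_into_rtrancl) simp

lemma component_D: assumes "d \<in> D v" shows "component v d \<subseteq> D v"
proof
  fix x assume "x \<in> component v d"
  then have "(d, x) \<in> {(x, y). x \<in> D v \<and> y \<in> D v \<and> adj x y}\<^sup>*" by (simp add: component_def)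
  then show "x \<in> D v" using assms by (induction rule: rtrancl_induct) auto
qed

lemma component_sym: "x \<in> component v d \<Longrightarrow> d \<in> component v x"
proof -
  have "sym {(x, y). x \<in> D v \<and> y \<in> D v \<and> adj x y}" using adj_sym by (auto intro: symI)
  then show "x \<in> component v d \<Longrightarrow> d \<in> component v x"
    unfolding component_def mem_Collect_eq by (meson sym_rtrancl symD)
qed

lemma component_trans: "x \<in> component v d \<Longrightarrow> y \<in> component v x \<Longrightarrow> y \<in> component v d"
  unfolding component_def mem_Collect_eq by (rule rtrancl_trans)

lemma component_eq: "x \<in> component v d \<Longrightarrow> component v x = component v d"
  using component_sym component_trans by blast

lemma connected_component_set: assumes d: "d \<in> D v" shows "connected_set (component v d)"
  unfolding connected_set_def
proof (intro allI impI)
  fix S assume S: "S \<subseteq> component v d" "S \<noteq> {}" and cl: "\<forall>x\<in>S. \<forall>y\<in>component v d. adj x y \<longrightarrow> y \<in> S"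
  obtain s where s: "s \<in> S" using S(2) by blast
  have "x \<in> S" if "x \<in> component v d" for x
  proof -
    have "x \<in> component v s" using that component_eq[of s v d] s S(1) by blast
    then have "(s, x) \<in> {(x, y). x \<in> D v \<and> y \<in> D v \<and> adj x y}\<^sup>*" by (simp add: component_def)
    then show ?thesis
    proof (induction rule: rtrancl_induct)
      case base show ?case by (rule s)
    next
      case (step y z)
      then have "z \<in> component v d" using component_step[of y v d z] S(1) by blast
      then show ?case using cl step by blast
    qed
  qed
  then show "S = component v d" using S(1) by blast
qed

context
  fixes v :: "5 \<Rightarrow> 'a" and c :: "'a \<Rightarrow> nat" and w :: nat
  assumes cyc: "cyc v" and ne: "YY v \<noteq> {}" and good: "good_colouring v c"
    and con: "connected_set V" and w: "\<And>K. clique K \<Longrightarrow> card K \<le> w"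
begin

lemma component_homogeneous:
  assumes d: "d \<in> D v" and q: "q \<in> component v d" and q': "q' \<in> component v d"
    and hom: "\<And>x y. x \<in> component v d \<Longrightarrow> y \<in> component v d \<Longrightarrow> adj x y \<Longrightarrow> adj x z \<Longrightarrow> adj y z"
    and qz: "adj q z"
  shows "adj q' z"
proof -
  have "{x \<in> component v d. adj x z} = component v d"
    by (rule connected_setD[OF connected_component_set[OF d]]) (use q qz hom in blast)+
  then show ?thesis using q' by blast
qed

lemma component_Y: 
  assumes d: "d \<in> D v" and q: "q \<in> component v d" "q' \<in> component v d" and z: "z \<in> YY v" and qz: "adj q z"
  shows "adj q' z"
proof (rule component_homogeneous[OF d q _ qz])
  fix x y assume "x \<in> component v d" "y \<in> component v d" "adj x y" "adj x z"
  then show "adj y z" using D_homogeneous_Y[OF cyc] component_D[OF d] z unfolding YY_def by blast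
qed

text \<open>A neighbour of type \<open>Y\<close> is always shared by the whole component. If there
  is none, a vertex of type \<open>F\<close> or \<open>W\<close> is shared, where the
  \<open>W\<close> case needs some vertex of type \<open>Y\<close> that the component
  misses.\<close>

lemma component_attached:
  assumes d: "d \<in> D v"
  shows "\<exists>z. \<forall>q\<in>component v d. adj z q"
proof -
  have DV: "D v \<subseteq> V" unfolding D_def by blast
  have "\<exists>q\<in>component v d. \<exists>z\<in>YY v \<union> ZZ v. adj q z"
  proof (rule ccontr)
    assume no: "\<not> ?thesis"
    have "component v d = V"
    proof (rule connected_setD[OF con])
      show "component v d \<subseteq> V" using component_D[OF d] DV by blast
      show "component v d \<noteq> {}" using component_self by blast
      fix x y assume xy: "x \<in> component v d" "y \<in> V" "adj x y"
      have x: "x \<in> D v" using component_D[OF d] xy(1) by blast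
      have "y \<notin> AA v" using AA_D_anticomplete[OF cyc _ x] xy(3) adj_sym[of x y] by blast
      then have "y \<in> D v" using V_cases[OF cyc] no xy by blast
      then show "y \<in> component v d" using component_step x xy by blast
    qed
    moreover have "v 0 \<in> V" using adj_V[of "v 0" "v 1"] by (simp add: v_adj[OF cyc])
    moreover have "v 0 \<notin> D v" using v_adj[OF cyc, of 0 1] unfolding D_def by auto
    ultimately show False using component_D[OF d] by blast
  qed
  then obtain q z where q: "q \<in> component v d" and z: "z \<in> YY v \<union> ZZ v" "adj q z" by blast
  show ?thesis
  proof (cases "\<exists>p\<in>component v d. \<exists>y\<in>YY v. adj p y")
    case True
    then obtain p y where p: "p \<in> component v d" "y \<in> YY v" "adj p y" by blast
    have "adj y q'" if "q' \<in> component v d" for q'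
      using component_Y[OF d p(1) that p(2,3)] adj_sym[of y q'] by simp
    then show ?thesis by blast
  next
    case False
    then have zZ: "z \<in> ZZ v" using q z by blast
    obtain y i where y: "y \<in> Y v i" using ne unfolding YY_def by blast
    have yY: "y \<in> YY v" using y unfolding YY_def by blast
    have "adj z q'" if q': "q' \<in> component v d" for q'
    proof -
      have "adj q' z"
      proof (rule component_homogeneous[OF d q q' _ z(2)])
        fix x x' assume x: "x \<in> component v d" "x' \<in> component v d" "adj x x'" "adj x z"
        then have D: "x \<in> D v" "x' \<in> D v" using component_D[OF d] by blast+
        have n: "\<not> adj x y" "\<not> adj x' y" using False x yY by blast+
        consider "z \<in> W v" | i where "z \<in> F v i" using zZ unfolding ZZ_def by blast
        then show "adj x' z"
        proof cases
          case 1 then show ?thesis using D_homogeneous_W[OF cyc D x(3) _ x(4) y n] by blast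
        next
          case 2 then show ?thesis using D_homogeneous_F[OF cyc D x(3) _ x(4)] by blast
        qed
      qed
      then show ?thesis using adj_sym[of z q'] by simp
    qed
    then show ?thesis by blast
  qed
qed

lemma w_ge_3: "3 \<le> w"
proof -
  obtain y i where y: "y \<in> Y v i" using ne unfolding YY_def by blast
  let ?K = "{y, v (i+2), v (i+3)}"
  have adj: "adj y (v (i+2))" "adj y (v (i+3))" "adj (v (i+2)) (v (i+3))"
    using Y_adj[OF cyc y] by (simp_all add: v_adj[OF cyc])
  have adj': "adj (v (i+2)) y" "adj (v (i+3)) y" "adj (v (i+3)) (v (i+2))"
    using adj adj_sym by blast+
  have "clique ?K" unfolding clique_def using adj adj' adj_V by blast
  moreover have "card ?K = 3"
    using adj adj_irrefl by (metis card_3_iff)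
  ultimately show ?thesis using w by metis
qed

lemma component_colouring:
  assumes d: "d \<in> D v"
  shows "\<exists>g. (\<forall>x\<in>component v d. g x < w + 3) \<and> (\<forall>x\<in>component v d. \<forall>y\<in>component v d. adj x y \<longrightarrow> g x \<noteq> g y) \<and>
    (\<forall>x\<in>component v d. \<forall>y\<in>YY v. adj x y \<longrightarrow> g x \<noteq> c y) \<and> (\<forall>x\<in>component v d. \<forall>z\<in>ZZ v. adj x z \<longrightarrow> g x \<noteq> 5)"
proof -
  let ?Q = "component v d"
  define S where "S = {y \<in> YY v. \<exists>q\<in>?Q. adj q y}"
  have SY: "S \<subseteq> YY v" unfolding S_def by blast
  have c5: "c ` S \<subseteq> {..<5}" using good_colouringD(1)[OF good] SY by auto
  have fin: "finite (c ` S)" using finite_subset[OF c5] by simp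
  have QV: "?Q \<subseteq> V" using component_D[OF d] unfolding D_def by blast
  have SQ: "adj q y" if "y \<in> S" "q \<in> ?Q" for q y
    using that component_Y[OF d _ that(2)] unfolding S_def by blast
  \<comment> \<open>\<open>P\<close> is a palette of permitted colours, and any proper colouring
    with \<open>card P\<close> colours is renamed into it.\<close>
  have pal: ?thesis if P: "P \<subseteq> {..<w+3} - c ` S" "finite P" and P5: "5 \<notin> P \<or> (\<forall>x\<in>?Q. \<forall>z\<in>ZZ v. \<not> adj x z)"
    and f: "\<forall>x\<in>?Q. f x < card P" "\<forall>x\<in>?Q. \<forall>y\<in>?Q. adj x y \<longrightarrow> f x \<noteq> (f y :: nat)" for P f
  proof -
    obtain h where h: "bij_betw h {0..<card P} P" using ex_bij_betw_nat_finite[OF P(2)] by blast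
    have hP: "h (f x) \<in> P" if "x \<in> ?Q" for x
      using h f(1) that unfolding bij_betw_def by (metis atLeast0LessThan imageI lessThan_iff)
    have hinj: "h (f x) \<noteq> h (f y)" if "x \<in> ?Q" "y \<in> ?Q" "adj x y" for x y
      using h f that unfolding bij_betw_def inj_on_def by (metis atLeast0LessThan lessThan_iff)
    show ?thesis
    proof (intro exI[of _ "\<lambda>x. h (f x)"] conjI ballI impI)
      fix x assume x: "x \<in> ?Q"
      show "h (f x) < w + 3" using hP[OF x] P(1) by blast
      show "h (f x) \<noteq> h (f y)" if "y \<in> ?Q" "adj x y" for y using hinj[OF x that] .
      show "h (f x) \<noteq> c y" if "y \<in> YY v" "adj x y" for y
        using hP[OF x] P(1) that x unfolding S_def by blast
      show "h (f x) \<noteq> 5" if "z \<in> ZZ v" "adj x z" for z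
        using hP[OF x] P5 that x by metis
    qed
  qed
  show ?thesis
  proof (cases "\<exists>x\<in>?Q. \<exists>y\<in>?Q. adj x y")
    case True
    then obtain x y where xy: "x \<in> ?Q" "y \<in> ?Q" "adj x y" by blast
    have "stable_set S"
      unfolding stable_set_def
    proof (intro ballI)
      fix a b assume ab: "a \<in> S" "b \<in> S"
      show "\<not> adj a b"
        by (rule D_edge_Y_Y[OF cyc _ _ xy(3)]) (use ab SY SQ xy component_D[OF d] in blast)+
    qed
    then have card2: "card (c ` S) \<le> 2" using good_colouringD(3)[OF good] SY by blast
    \<comment> \<open>Two colours from the neighbours of type \<open>Y\<close> and colour 5 are
      removed, so \<open>w\<close> remain.\<close>
    let ?P = "{..<w+3} - (c ` S \<union> {5})"
    have "card (c ` S \<union> {5}) \<le> 3" using card2 card_Un_le[of "c ` S" "{5}"] by simp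
    moreover have "card {..<w+3} - card (c ` S \<union> {5}) \<le> card ?P"
      using fin by (intro diff_card_le_card_Diff) simp
    ultimately have wP: "w \<le> card ?P" by simp
    obtain z where z: "\<forall>q\<in>?Q. adj z q" using component_attached[OF d] by blast
    obtain f where f: "\<forall>x\<in>?Q. f x < w" "\<forall>x\<in>?Q. \<forall>y\<in>?Q. adj x y \<longrightarrow> f x \<noteq> (f y :: nat)"
      using neighbourhood_colourable[OF connected_component_set[OF d] QV _ w w_ge_3, of z] z by blast
    show ?thesis by (rule pal[of ?P f]) (use wP f in force)+
  next
    case False
    have one: ?thesis if "k < w + 3" "k \<notin> c ` S" "k \<noteq> 5 \<or> (\<forall>x\<in>?Q. \<forall>z\<in>ZZ v. \<not> adj x z)" for k
      by (rule pal[of "{k}" "\<lambda>_. 0"]) (use that False in auto)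
    show ?thesis
    proof (cases "\<forall>x\<in>?Q. \<forall>z\<in>ZZ v. \<not> adj x z")
      case True
      have "5 \<notin> c ` S" using c5 by blast
      then show ?thesis using one[of 5] True w_ge_3 by simp
    next
      case Z: False
      show ?thesis
      proof (cases "card (c ` S) \<ge> 5")
        case True
        obtain q z where qz: "q \<in> ?Q" "z \<in> ZZ v" "adj q z" using Z by blast
        obtain x y where xy: "x \<in> S" "y \<in> S" "adj x y" "adj z x" "adj z y"
          using good_colouringD(4)[OF good] SY True qz(2) by blast
        have q: "adj q x" "adj q y" using SQ xy qz by blast+
        have "clique {x, y, z, q}"
          unfolding clique_def using xy q qz adj_sym adj_V by auto
        then have "card {x, y, z, q} \<le> w" by (rule w)
        moreover have "card {x, y, z, q} = 4"
        proof -
          have "x \<noteq> y" "x \<noteq> z" "x \<noteq> q" "y \<noteq> z" "y \<noteq> q" "z \<noteq> q" using xy q qz adj_irrefl by blast+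
          then show ?thesis by simp
        qed
        ultimately have "6 < w + 3" by simp
        moreover have "6 \<notin> c ` S" using c5 by force
        ultimately show ?thesis using one[of 6] by simp
      next
        case False
        then have "\<not> {..<5} \<subseteq> c ` S" using card_mono[OF fin, of "{..<5}"] by auto
        then obtain k where "k < 5" "k \<notin> c ` S" by blast
        then show ?thesis using one[of k] w_ge_3 by simp
      qed
    qed
  qed
qed

lemma colouring_exists:
  "\<exists>f. (\<forall>x\<in>V. f x < w + 3) \<and> (\<forall>x y. adj x y \<longrightarrow> f x \<noteq> f y)"
proof -
  define good_component where "good_component Q g \<longleftrightarrow>
    (\<forall>x\<in>Q. g x < w + 3) \<and> (\<forall>x\<in>Q. \<forall>y\<in>Q. adj x y \<longrightarrow> g x \<noteq> g y) \<and>
    (\<forall>x\<in>Q. \<forall>y\<in>YY v. adj x y \<longrightarrow> g x \<noteq> c y) \<and> (\<forall>x\<in>Q. \<forall>z\<in>ZZ v. adj x z \<longrightarrow> g x \<noteq> 5)"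
    for Q and g :: "'a \<Rightarrow> nat"
  \<comment> \<open>The choice depends only on the vertex set, so all vertices of one component use
    the same colouring.\<close>
  define G where "G Q = (SOME g. good_component Q g)" for Q
  have G: "good_component (component v d) (G (component v d))" if "d \<in> D v" for d
  proof -
    have "\<exists>g. good_component (component v d) g" unfolding good_component_def by (rule component_colouring[OF that])
    then show ?thesis unfolding G_def by (rule someI_ex)
  qed
  define f where "f x = (if x \<in> D v then G (component v x) x else if x \<in> ZZ v then 5 else c x)" for x
  have V: "x \<in> AA v \<union> YY v" if "x \<in> V" "x \<notin> D v" "x \<notin> ZZ v" for x
    using V_cases[OF cyc] that by blast
  have c: "c x < 5" if "x \<in> AA v \<union> YY v" for x
    using good_colouringD(1)[OF good] that by blast
  have out: "f x \<noteq> f y" if xy: "adj x y" "x \<in> D v" "y \<notin> D v" for x y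
  proof -
    have y: "y \<in> V" using adj_V xy(1) adj_sym[of x y] by blast
    have "y \<notin> AA v" using AA_D_anticomplete[OF cyc _ xy(2)] xy(1) adj_sym[of x y] by blast
    then have "y \<in> ZZ v \<or> y \<in> YY v" using V_cases[OF cyc] y xy(3) by blast
    then show ?thesis
      using G[OF xy(2)] xy component_self[of x v] \<open>y \<notin> AA v\<close> V[OF y xy(3)]
      unfolding good_component_def f_def by auto
  qed
  have "f x < w + 3" if x: "x \<in> V" for x
    using G[of x] component_self[of x v] V[OF x] c[of x] w_ge_3 unfolding good_component_def f_def by auto
  moreover have "f x \<noteq> f y" if xy: "adj x y" for x y
  proof -
    have yx: "adj y x" using xy adj_sym[of x y] by simp
    have xyV: "x \<in> V" "y \<in> V" using adj_V xy yx by blast+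
    consider "x \<in> D v" "y \<in> D v" | "x \<in> D v" "y \<notin> D v" | "x \<notin> D v" "y \<in> D v"
      | "x \<notin> D v" "y \<notin> D v" by blast
    then show ?thesis
    proof cases
      case 1
      have y: "y \<in> component v x" by (rule component_step[OF component_self 1 xy])
      then have "component v y = component v x" by (rule component_eq)
      then show ?thesis using G[OF 1(1)] component_self[of x v] y xy 1 unfolding good_component_def f_def by simp
    next
      case 2 then show ?thesis using out xy by blast
    next
      case 3 then show ?thesis using out[OF yx] by metis
    next
      case 4
      have "\<not> (x \<in> ZZ v \<and> y \<in> ZZ v)" using stable_ZZ[OF cyc] xy unfolding stable_set_def by blast
      then consider "x \<in> ZZ v" "y \<notin> ZZ v" | "x \<notin> ZZ v" "y \<in> ZZ v" | "x \<notin> ZZ v" "y \<notin> ZZ v" by blast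
      then show ?thesis
      proof cases
        case 1 then show ?thesis using 4 c[OF V[OF xyV(2) 4(2) 1(2)]] unfolding f_def by simp
      next
        case 2 then show ?thesis using 4 c[OF V[OF xyV(1) 4(1) 2(1)]] unfolding f_def by simp
      next
        case 3
        then show ?thesis
          using good_colouringD(2)[OF good] V[OF xyV(1) 4(1) 3(1)] V[OF xyV(2) 4(2) 3(2)] xy 4
          unfolding f_def by simp
      qed
    qed
  qed
  ultimately show ?thesis by blast
qed

end
end

section \<open>Transfer to pair graphs\<close>

lemma pair_graph_wheel_graph:
  fixes G :: "'a pair_pre_digraph"
  assumes G: "pair_graph G" and P5: "\<not> contains_induced G P5" and HVN: "\<not> contains_induced G HVN"
    and T: "\<not> contains_induced G T_5_wheel"
  shows "wheel_graph (pverts G) (\<lambda>x y. (x, y) \<in> parcs G)"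
proof -
  interpret pair_graph G by fact
  let ?adj = "\<lambda>x y. (x, y) \<in> parcs G"
  have sym: "?adj x y = ?adj y x" for x y
    using pair_sym_arcs by (auto simp: symmetric_def dest: symD)
  have irr: "\<not> ?adj x x" for x using pair_no_loops[of "(x, x)"] by auto
  have inV: "x \<in> pverts G" "y \<in> pverts G" if "?adj x y" for x y
    using that in_arcsD1 in_arcsD2 by blast+
  show ?thesis
  proof
    show "finite (pverts G)" by (rule pair_finite_verts)
    show "x \<in> pverts G" if "?adj x y" for x y using inV that by blast
    show "\<not> ?adj x x" for x by (rule irr)
    show "?adj x y = ?adj y x" for x y by (rule sym)
    fix a b c d e x :: 'a
    let ?f = "\<lambda>n::nat. if n = 1 then a else if n = 2 then b else if n = 3 then c else if n = 4 then d
      else if n = 5 then e else x"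
    show "\<not> (?adj a b \<and> ?adj b c \<and> ?adj c d \<and> ?adj d e \<and>
      \<not> ?adj a c \<and> \<not> ?adj a d \<and> \<not> ?adj a e \<and> \<not> ?adj b d \<and> \<not> ?adj b e \<and> \<not> ?adj c e)"
    proof
      assume h: "?adj a b \<and> ?adj b c \<and> ?adj c d \<and> ?adj d e \<and>
        \<not> ?adj a c \<and> \<not> ?adj a d \<and> \<not> ?adj a e \<and> \<not> ?adj b d \<and> \<not> ?adj b e \<and> \<not> ?adj c e"
      have wf: "pair_wf_digraph P5" unfolding P5_def by (rule pair_wf_digraph_graph_of) auto
      have "a \<noteq> b" "a \<noteq> c" "a \<noteq> d" "a \<noteq> e" "b \<noteq> c" "b \<noteq> d" "b \<noteq> e" "c \<noteq> d" "c \<noteq> e" "d \<noteq> e"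
        using h irr sym by blast+
      moreover have "a \<in> pverts G" "b \<in> pverts G" "c \<in> pverts G" "d \<in> pverts G" "e \<in> pverts G"
        using h inV by blast+
      ultimately have "contains_induced G P5"
        unfolding contains_induced_iff_embedding[OF wf] using h irr sym
        by (intro exI[of _ ?f]) (simp add: P5_def)
      then show False using P5 by blast
    qed
    show "\<not> (?adj a b \<and> ?adj a c \<and> ?adj a d \<and> ?adj b c \<and> ?adj b d \<and> ?adj c d \<and>
      ?adj e a \<and> ?adj e b \<and> \<not> ?adj e c \<and> \<not> ?adj e d)"
    proof
      assume h: "?adj a b \<and> ?adj a c \<and> ?adj a d \<and> ?adj b c \<and> ?adj b d \<and> ?adj c d \<and>
        ?adj e a \<and> ?adj e b \<and> \<not> ?adj e c \<and> \<not> ?adj e d"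
      have wf: "pair_wf_digraph HVN" unfolding HVN_def by (rule pair_wf_digraph_graph_of) auto
      have "a \<noteq> b" "a \<noteq> c" "a \<noteq> d" "a \<noteq> e" "b \<noteq> c" "b \<noteq> d" "b \<noteq> e" "c \<noteq> d" "c \<noteq> e" "d \<noteq> e"
        using h irr sym by blast+
      moreover have "a \<in> pverts G" "b \<in> pverts G" "c \<in> pverts G" "d \<in> pverts G" "e \<in> pverts G"
        using h inV by blast+
      ultimately have "contains_induced G HVN"
        unfolding contains_induced_iff_embedding[OF wf] using h irr sym
        by (intro exI[of _ ?f]) (simp add: HVN_def)
      then show False using HVN by blast
    qed
    show "\<not> (?adj a b \<and> ?adj b c \<and> ?adj c d \<and> ?adj d e \<and> ?adj e a \<and>
      \<not> ?adj a c \<and> \<not> ?adj a d \<and> \<not> ?adj b d \<and> \<not> ?adj b e \<and> \<not> ?adj c e \<and>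
      ?adj x e \<and> ?adj x a \<and> ?adj x b \<and> \<not> ?adj x c \<and> \<not> ?adj x d)"
    proof
      assume h: "?adj a b \<and> ?adj b c \<and> ?adj c d \<and> ?adj d e \<and> ?adj e a \<and>
        \<not> ?adj a c \<and> \<not> ?adj a d \<and> \<not> ?adj b d \<and> \<not> ?adj b e \<and> \<not> ?adj c e \<and>
        ?adj x e \<and> ?adj x a \<and> ?adj x b \<and> \<not> ?adj x c \<and> \<not> ?adj x d"
      have wf: "pair_wf_digraph T_5_wheel" unfolding T_5_wheel_def by (rule pair_wf_digraph_graph_of) auto
      have "a \<noteq> b" "a \<noteq> c" "a \<noteq> d" "a \<noteq> e" "b \<noteq> c" "b \<noteq> d" "b \<noteq> e" "c \<noteq> d" "c \<noteq> e" "d \<noteq> e"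
        "a \<noteq> x" "b \<noteq> x" "c \<noteq> x" "d \<noteq> x" "e \<noteq> x"
        using h irr sym by blast+
      moreover have "a \<in> pverts G" "b \<in> pverts G" "c \<in> pverts G" "d \<in> pverts G" "e \<in> pverts G" "x \<in> pverts G"
        using h inV by blast+
      ultimately have "contains_induced G T_5_wheel"
        unfolding contains_induced_iff_embedding[OF wf] using h irr sym
        by (intro exI[of _ ?f]) (simp add: T_5_wheel_def)
      then show False using T by blast
    qed
  qed
qed

theorem theorem4p5:
  fixes G :: "'a pair_pre_digraph"
  assumes "pair_graph G"
    and "Digraph_Component.connected (with_proj G)"
    and "\<not> contains_induced G P5"
    and "\<not> contains_induced G HVN"
    and "contains_induced G Y_5_wheel"
    and "\<not> contains_induced G T_5_wheel"
  shows "colorable G (clique_number G + 3)"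
proof -
  interpret G: pair_graph G by fact
  let ?adj = "\<lambda>x y. (x, y) \<in> parcs G"
  interpret wheel_graph "pverts G" ?adj
    by (rule pair_graph_wheel_graph) fact+
  have wfY: "pair_wf_digraph Y_5_wheel" unfolding Y_5_wheel_def by (rule pair_wf_digraph_graph_of) auto
  obtain f where f: "\<forall>u \<in> pverts Y_5_wheel. \<forall>v \<in> pverts Y_5_wheel.
      (u, v) \<in> parcs Y_5_wheel \<longleftrightarrow> ?adj (f u) (f v)"
    using assms(5) unfolding contains_induced_iff_embedding[OF wfY] by blast
  let ?v = "cyc_of (f 1) (f 2) (f 3) (f 4) (f 5)"
  have "cyc ?v" by (rule cyc_cyc_of) (use f in \<open>simp_all add: Y_5_wheel_def\<close>)
  \<comment> \<open>The hub sees the wheel vertices 1, 2 and 4, that is, the indices 0, 1 and 3; the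
    index without a neighbouring one among them is 3.\<close>
  moreover have "f 6 \<in> Y ?v 3"
    unfolding Y_def mem_Collect_eq all_five[of _ 0] add_0 cyc_of_simps
    using f by (simp add: Y_5_wheel_def)
  ultimately obtain v c where v: "cyc v" "YY v \<noteq> {}" "good_colouring v c"
    using exists_good_colouring[of ?v] unfolding YY_def by blast
  have con: "connected_set (pverts G)"
    unfolding connected_set_def
  proof (intro allI impI)
    fix S assume S: "S \<subseteq> pverts G" "S \<noteq> {}" and cl: "\<forall>x\<in>S. \<forall>y\<in>pverts G. ?adj x y \<longrightarrow> y \<in> S"
    obtain s where s: "s \<in> S" using S(2) by blast
    have "x \<in> S" if x: "x \<in> pverts G" for x
    proof -
      \<comment> \<open>Connectivity of a digraph is strong connectivity of its symmetric closure,
        whose arcs are again edges of \<open>G\<close> by symmetry.\<close>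
      have "s \<rightarrow>\<^sup>*\<^bsub>with_proj (mk_symmetric (with_proj G))\<^esub> x"
        using assms(2) s S(1) x
        unfolding Digraph_Component.connected_def strongly_connected_def by (auto simp: mk_symmetric_def)
      then have "(s, x) \<in> (arcs_ends (with_proj (mk_symmetric (with_proj G))))\<^sup>*"
        by (rule reachable_rtranclI)
      then have "(s, x) \<in> (parcs (mk_symmetric (with_proj G)))\<^sup>*" by simp
      then show ?thesis
      proof (induction rule: rtrancl_induct)
        case base show ?case by (rule s)
      next
        case (step y z)
        then have "?adj y z" using adj_sym by (auto simp: mk_symmetric_def)
        then show ?case using cl step.IH G.in_arcsD2 by blast
      qed
    qed
    then show "S = pverts G" using S(1) by blast
  qed
  have "card K \<le> clique_number G" if "clique K" for K
  proof -
    have "{S. clique_in G S} \<subseteq> Pow (pverts G)" unfolding clique_in_def by blast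
    then have "finite {S. clique_in G S}" using finite_V by (meson finite_Pow_iff finite_subset)
    moreover have "clique_in G K" using that unfolding clique_def clique_in_def .
    ultimately show ?thesis unfolding clique_number_def by (intro Max_ge) auto
  qed
  from colouring_exists[OF v con this] show ?thesis
    unfolding colorable_def by auto
qed

end
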